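(* Let $X\subset\mathbb{R}^n$ be compact and let $f:\mathbb{R}^n\to\mathbb{R}^n$ be a locally Lipschitz continuous vector field. Let $\mathbf{A}$ be the minimal attractor for $X$ for the dynamical system induced by $f$ (assumed to exist). Then the optimal value $p_{\mathrm{MA}}^*$ of the linear program $$p_{\mathrm{MA}}^*=\inf\ \int_X w(x)\,dx+\varepsilon\,\lambda(X)$$ over all $(w,J,\varepsilon)\in\mathcal{C}(X)\times\mathcal{C}^1(\mathbb{R}^n)\times[0,\infty)$ satisfying, on $X$, $$w+J\ge 1,\qquad w\ge 0,\qquad J\ge 0,\qquad \nabla J\cdot f+J\le\varepsilon,$$ satisfies $$p_{\mathrm{MA}}^*=\lambda(\mathbf{A}).$$ For any feasible $(w,J,\varepsilon)$ we have $$\mathbf{A}\subset K:=J^{-1}([0,\varepsilon])\cap X$$ with $$\lambda(K\setminus\mathbf{A})\le\int_X w(x)\,dx+\varepsilon\,\lambda(X)-p_{\mathrm{MA}}^*,$$ where the right-hand side (and hence $\lambda(K\setminus\mathbf{A})$) converges to zero as $(w,J,\varepsilon)$ gets optimal, i.e. along any sequence of feasible triples whose costs converge to $p_{\mathrm{MA}}^*$. Further, $J^{-1}([0,\varepsilon])$ is positively invariant if $J^{-1}([0,\varepsilon])\subset\mathring{X}$.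
   Context: $\lambda$ is the Lebesgue measure on $\mathbb{R}^n$; $\mathring{X}$ is the interior of $X$; $\mathcal{C}(X)$ is the space of continuous functions on $X$ and $\mathcal{C}^1(\mathbb{R}^n)$ the space of continuously differentiable functions on $\mathbb{R}^n$. $\varphi_t(x_0)$ denotes the solution at time $t\ge 0$ of $\dot x=f(x)$, $x(0)=x_0$; a condition on $\varphi_t(x)$ for all $t\ge0$, or as $t\to\infty$, includes that the solution exists for all $t\ge 0$. $\mathrm{dist}(x,A)$ is the Euclidean distance from a point to a set. A set $S\subset\mathbb{R}^n$ is positively invariant if $\varphi_t(x)\in S$ for all $x\in S$ and $t\ge 0$. The basin of attraction of $A\subset\mathbb{R}^n$ is $B_f(A)=\{x\in\mathbb{R}^n:\lim_{t\to\infty}\mathrm{dist}(\varphi_t(x),A)=0\}$. The set $A$ is asymptotically stable if $B_f(A)$ is an open neighbourhood of $A$ and $A$ is stable, i.e. for all $\epsilon>0$ there is $\delta>0$ such that for all $y\in\mathbb{R}^n$ with $\mathrm{dist}(y,A)<\delta$ we have $\mathrm{dist}(\varphi_t(y),A)<\epsilon$ for all $t\ge 0$. A non-empty compact set $A\subset X$ is a stable compact attractor for $X$ if it is positively invariant, asymptotically stable and $B_f(A)\supset X$. It is the minimal attractor for $X$ if moreover no strict subset of $A$ is a stable compact attractor for $X$; the minimal attractor, when it exists, is unique. *)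

theory Defs
  imports "HOL-Analysis.Analysis"
begin

definition locally_lipschitz :: "(real^'n \<Rightarrow> real^'n) \<Rightarrow> bool" where
  "locally_lipschitz f \<longleftrightarrow> local_lipschitz (UNIV :: real set) UNIV (\<lambda>_. f)"

definition ode_solution :: "(real^'n \<Rightarrow> real^'n) \<Rightarrow> real^'n \<Rightarrow> real \<Rightarrow> (real \<Rightarrow> real^'n) \<Rightarrow> bool" where
  "ode_solution f x0 T y \<longleftrightarrow>
     y 0 = x0 \<and> (\<forall>t\<in>{0..T}. (y has_vector_derivative f (y t)) (at t within {0..T}))"

definition global_forward :: "(real^'n \<Rightarrow> real^'n) \<Rightarrow> real^'n \<Rightarrow> bool" where
  "global_forward f x0 \<longleftrightarrow> (\<forall>T\<ge>0. \<exists>y. ode_solution f x0 T y)"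

text \<open>For a locally Lipschitz field, solutions on \<open>[0, t]\<close> are unique, so \<open>flow f t x0\<close> is
  \<open>\<phi>\<^sub>t(x0)\<close> whenever a solution exists up to time \<open>t\<close>; otherwise it is unspecified. Every condition
  below on the whole forward orbit therefore also demands \<open>global_forward\<close>.\<close>

definition flow :: "(real^'n \<Rightarrow> real^'n) \<Rightarrow> real \<Rightarrow> real^'n \<Rightarrow> real^'n" where
  "flow f t x0 = (THE p. \<exists>y. ode_solution f x0 t y \<and> y t = p)"

definition positively_invariant :: "(real^'n \<Rightarrow> real^'n) \<Rightarrow> (real^'n) set \<Rightarrow> bool" where
  "positively_invariant f S \<longleftrightarrow> (\<forall>x\<in>S. global_forward f x \<and> (\<forall>t\<ge>0. flow f t x \<in> S))"

text \<open>\<open>infdist\<close> is the distance to a set, except that \<open>infdist x {} = 0\<close>; the three notions that use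
  it are only applied to non-empty sets.\<close>

definition basin :: "(real^'n \<Rightarrow> real^'n) \<Rightarrow> (real^'n) set \<Rightarrow> (real^'n) set" where
  "basin f A = {x. global_forward f x \<and> ((\<lambda>t. infdist (flow f t x) A) \<longlongrightarrow> 0) at_top}"

definition stable :: "(real^'n \<Rightarrow> real^'n) \<Rightarrow> (real^'n) set \<Rightarrow> bool" where
  "stable f A \<longleftrightarrow>
     (\<forall>\<epsilon>>0. \<exists>\<delta>>0. \<forall>y. infdist y A < \<delta> \<longrightarrow>
        global_forward f y \<and> (\<forall>t\<ge>0. infdist (flow f t y) A < \<epsilon>))"

definition asymptotically_stable :: "(real^'n \<Rightarrow> real^'n) \<Rightarrow> (real^'n) set \<Rightarrow> bool" where
  "asymptotically_stable f A \<longleftrightarrow> open (basin f A) \<and> A \<subseteq> basin f A \<and> stable f A"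

definition stable_compact_attractor ::
    "(real^'n \<Rightarrow> real^'n) \<Rightarrow> (real^'n) set \<Rightarrow> (real^'n) set \<Rightarrow> bool" where
  "stable_compact_attractor f X A \<longleftrightarrow>
     A \<noteq> {} \<and> compact A \<and> A \<subseteq> X \<and>
     positively_invariant f A \<and> asymptotically_stable f A \<and> X \<subseteq> basin f A"

definition minimal_attractor ::
    "(real^'n \<Rightarrow> real^'n) \<Rightarrow> (real^'n) set \<Rightarrow> (real^'n) set \<Rightarrow> bool" where
  "minimal_attractor f X A \<longleftrightarrow>
     stable_compact_attractor f X A \<and> (\<forall>B. B \<subset> A \<longrightarrow> \<not> stable_compact_attractor f X B)"

definition gradient :: "(real^'n \<Rightarrow> real) \<Rightarrow> real^'n \<Rightarrow> real^'n" where
  "gradient J x = (THE D. GDERIV J x :> D)"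

definition C1 :: "(real^'n \<Rightarrow> real) \<Rightarrow> bool" where
  "C1 J \<longleftrightarrow> J differentiable_on UNIV \<and> continuous_on UNIV (gradient J)"

text \<open>An element of \<open>\<C>(X)\<close> is represented by a total function that is continuous on \<open>X\<close>; neither
  feasibility nor the cost depends on its values outside \<open>X\<close>.\<close>

definition feasible ::
    "(real^'n \<Rightarrow> real^'n) \<Rightarrow> (real^'n) set \<Rightarrow>
     ((real^'n \<Rightarrow> real) \<times> (real^'n \<Rightarrow> real) \<times> real) set" where
  "feasible f X = {(w, J, \<epsilon>).
     continuous_on X w \<and> C1 J \<and> \<epsilon> \<ge> 0 \<and>
     (\<forall>x\<in>X. w x + J x \<ge> 1 \<and> w x \<ge> 0 \<and> J x \<ge> 0 \<and> gradient J x \<bullet> f x + J x \<le> \<epsilon>)}"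

definition cost ::
    "(real^'n) set \<Rightarrow> (real^'n \<Rightarrow> real) \<times> (real^'n \<Rightarrow> real) \<times> real \<Rightarrow> real" where
  "cost X = (\<lambda>(w, J, \<epsilon>). (LINT x:X|lebesgue. w x) + \<epsilon> * measure lebesgue X)"

definition p_MA :: "(real^'n \<Rightarrow> real^'n) \<Rightarrow> (real^'n) set \<Rightarrow> real" where
  "p_MA f X = (INF z\<in>feasible f X. cost X z)"

text \<open>The infimum above is one of a non-empty set of reals that is bounded below, so taking it in
  the reals agrees with taking it in the extended reals.\<close>

lemma feasible_nonempty:
  fixes f :: "real^'n \<Rightarrow> real^'n"
  shows "feasible f X \<noteq> {}"
proof -
  have G: "GDERIV (\<lambda>_::real^'n. 0::real) x :> 0" for x
    by (rule GDERIV_const)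
  have "gradient (\<lambda>_::real^'n. 0::real) x = 0" for x
    unfolding gradient_def
  proof (rule the_equality)
    show "GDERIV (\<lambda>_::real^'n. 0::real) x :> 0" by (rule G)
  next
    fix D assume "GDERIV (\<lambda>_::real^'n. 0::real) x :> D"
    then have "(\<lambda>h. h \<bullet> D) = (\<lambda>h. h \<bullet> 0)"
      using G[of x] unfolding gderiv_def by (rule has_derivative_unique)
    then have "D \<bullet> D = D \<bullet> 0" by (rule fun_cong)
    then show "D = 0" by simp
  qed
  then have "gradient (\<lambda>_::real^'n. 0::real) = (\<lambda>_. 0)"
    by (rule ext)
  then have "(\<lambda>_. 1, \<lambda>_. 0, 0) \<in> feasible f X"
    by (simp add: feasible_def C1_def)
  then show ?thesis by blast
qed

lemma cost_bdd_below: "bdd_below (cost X ` feasible f X)"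
proof (rule bdd_belowI2)
  fix z assume "z \<in> feasible f X"
  then show "0 \<le> cost X z"
    by (auto simp: feasible_def cost_def set_lebesgue_integral_def indicator_def
             intro!: add_nonneg_nonneg integral_nonneg_AE)
qed

end

theory Submission
  imports Defs
begin

text \<open>Along the flow, feasibility gives \<open>(J - \<epsilon>)' \<le> - (J - \<epsilon>)\<close> inside \<open>X\<close>. The time-\<open>t\<close> image of
  the minimal attractor is again a stable compact attractor, so it is the whole attractor; every
  point of it thus has arbitrarily old ancestors in it, and \<open>J \<le> \<epsilon>\<close> follows there. On
  \<open>K = J\<^sup>-\<^sup>1([0, \<epsilon>]) \<inter> X\<close> one has \<open>w + \<epsilon> \<ge> 1\<close>, hence \<open>\<lambda>(K)\<close> bounds the cost from below. For
  the converse bound, \<open>V x = sup\<^sub>t e\<^sup>t g(\<phi>\<^sub>t x)\<close>, with \<open>g\<close> vanishing near the attractor and positive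
  further away, is Lipschitz and decays like \<open>e\<^sup>-\<^sup>t\<close> along the flow. Its mollification at a small
  scale is a feasible \<open>J\<close> for a small \<open>\<epsilon>\<close>, and at least 1 off a small neighbourhood of the attractor.\<close>

subsection \<open>Solutions and their dependence on the initial point\<close>

text \<open>The weight e^t is dictated by the constraint: \<open>J\<close> occurs in it with
  coefficient 1, and decay by the factor \<open>exp (- h)\<close> over a time \<open>h\<close> is
  its integrated form with slack 0. A positive slack then pays for smoothing. The obstacle is that
  the constraint is imposed only on \<open>X\<close>, which orbits may leave. The bound from below
  therefore uses ancestors inside the attractor, whose orbits remain in \<open>X\<close>, while
  \<open>J\<close> is built on a compact neighbourhood of \<open>X\<close> inside the basin, where
  orbits exist, stay in one ball and share one Lipschitz constant. As the Lyapunov function is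
  merely Lipschitz, its decay is expressed by difference inequalities, a form that survives
  averaging. The bound from above is proved for every stable compact attractor; minimality makes it
  meet the bound from below.\<close>

lemma gronwall_differential:
  fixes q q' :: "real \<Rightarrow> real"
  assumes t: "0 \<le> t" and cont: "continuous_on {0..t} q"
    and deriv: "\<And>s. 0 < s \<Longrightarrow> s < t \<Longrightarrow> (q has_real_derivative q' s) (at s)"
    and le: "\<And>s. 0 < s \<Longrightarrow> s < t \<Longrightarrow> q' s \<le> c * (q s - e)"
  shows "q t - e \<le> exp (c * t) * (q 0 - e)"
proof -
  \<comment> \<open>With this integrating factor the derivative of \<open>p\<close> is at most 0.
    The sign of \<open>c\<close> is left open: growth with \<open>c = 2 * L\<close> bounds the
    distance of two solutions, decay with \<open>c = - 1\<close> bounds \<open>J\<close> along an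
    orbit.\<close>
  define p where "p s = exp (- (c * s)) * (q s - e)" for s
  have "p t \<le> p 0"
  proof (rule DERIV_nonpos_imp_decreasing_open[OF t])
    fix s assume s: "0 < s" "s < t"
    have "(p has_real_derivative exp (- (c * s)) * (q' s - c * (q s - e))) (at s)"
      unfolding p_def
      by (rule derivative_eq_intros deriv s refl | simp)+ (simp add: algebra_simps)
    moreover have "exp (- (c * s)) * (q' s - c * (q s - e)) \<le> 0"
      using le[OF s] by (simp add: mult_le_0_iff)
    ultimately show "\<exists>y. DERIV p s :> y \<and> y \<le> 0" by blast
  next
    show "continuous_on {0..t} p"
      unfolding p_def by (intro continuous_intros cont)
  qed
  then have "exp (c * t) * p t \<le> exp (c * t) * (q 0 - e)"
    by (intro mult_left_mono) (auto simp: p_def)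
  moreover have "exp (c * t) * p t = q t - e"
    by (simp add: p_def exp_minus)
  ultimately show ?thesis by simp
qed

lemma ode_solution_continuous_on:
  assumes "ode_solution f x T y" shows "continuous_on {0..T} y"
  using assms unfolding ode_solution_def
  by (auto intro!: continuous_on_vector_derivative)

lemma ode_solution_deriv_at:
  assumes "ode_solution f x T y" "0 < s" "s < T"
  shows "(y has_vector_derivative f (y s)) (at s)"
proof -
  have "(y has_vector_derivative f (y s)) (at s within {0..T})"
    using assms by (auto simp: ode_solution_def)
  moreover have "at s within {0..T} = at s"
    using assms by (intro at_within_interior) auto
  ultimately show ?thesis by simp
qed

lemma ode_solution_restrict:
  assumes "ode_solution f x T y" "S \<le> T"
  shows "ode_solution f x S y"
proof -
  have sub: "{0..S} \<subseteq> {0..T}" using assms(2) by auto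
  show ?thesis
    using assms(1) sub unfolding ode_solution_def
    by (blast intro: has_vector_derivative_within_subset[OF _ sub])
qed

lemma ode_solution_shift:
  assumes y: "ode_solution f x (a + T) y" and a: "0 \<le> a"
  shows "ode_solution f (y a) T (\<lambda>t. y (a + t))"
  unfolding ode_solution_def
proof safe
  fix t assume t: "t \<in> {0..T}"
  have "(y has_vector_derivative f (y (a + t))) (at (a + t) within {0..a+T})"
    using y a t by (auto simp: ode_solution_def)
  then have "(y has_vector_derivative f (y (a + t))) (at (a + t) within ((+) a) ` {0..T})"
    by (rule has_vector_derivative_within_subset) (use a in auto)
  then have "((y \<circ> (+) a) has_vector_derivative 1 *\<^sub>R f (y (a + t))) (at t within {0..T})"
    by (intro vector_diff_chain_within)
       (auto intro!: derivative_eq_intros simp: has_vector_derivative_def)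
  then show "((\<lambda>t. y (a + t)) has_vector_derivative f (y (a + t))) (at t within {0..T})"
    by (simp add: o_def)
qed simp

text \<open>The squared distance is differentiable even where the two solutions meet, which the
  distance itself need not be. Cauchy-Schwarz and the Lipschitz bound give it growth rate
  \<open>2 * L\<close>; the square root at the end halves the rate.\<close>

lemma gronwall_ode:
  assumes u: "ode_solution f x T u" and v: "ode_solution f y T v"
    and L: "L-lipschitz_on S f"
    and S: "\<And>s. s \<in> {0..T} \<Longrightarrow> u s \<in> S \<and> v s \<in> S" and t: "t \<in> {0..T}"
  shows "dist (u t) (v t) \<le> exp (L * t) * dist x y"
proof -
  define q where "q s = (u s - v s) \<bullet> (u s - v s)" for s
  have L0: "0 \<le> L" using L by (rule lipschitz_on_nonneg)
  have "q t - 0 \<le> exp ((2 * L) * t) * (q 0 - 0)"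
  proof (rule gronwall_differential[where q' = "\<lambda>s. 2 * ((u s - v s) \<bullet> (f (u s) - f (v s)))"])
    show "0 \<le> t" using t by simp
    show "continuous_on {0..t} q"
      unfolding q_def
      by (intro continuous_intros continuous_on_subset[OF ode_solution_continuous_on[OF u]]
          continuous_on_subset[OF ode_solution_continuous_on[OF v]]) (use t in auto)
  next
    fix s assume s: "0 < s" "s < t"
    then have "s < T" using t by simp
    have w: "((\<lambda>s. u s - v s) has_vector_derivative f (u s) - f (v s)) (at s)"
      by (intro has_vector_derivative_diff ode_solution_deriv_at[OF u] ode_solution_deriv_at[OF v]
          \<open>s < T\<close> s(1))
    show "(q has_real_derivative 2 * ((u s - v s) \<bullet> (f (u s) - f (v s)))) (at s)"
      unfolding q_def has_field_derivative_def
      by (rule has_derivative_eq_rhs[OF has_derivative_inner[OF w[unfolded has_vector_derivative_def]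
              w[unfolded has_vector_derivative_def]]])
         (simp add: inner_commute fun_eq_iff)
    have "(u s - v s) \<bullet> (f (u s) - f (v s)) \<le> norm (u s - v s) * norm (f (u s) - f (v s))"
      by (rule norm_cauchy_schwarz)
    also have "\<dots> \<le> norm (u s - v s) * (L * norm (u s - v s))"
      using lipschitz_onD[OF L, of "u s" "v s"] S[of s] s \<open>s < T\<close>
      by (intro mult_left_mono) (auto simp: dist_norm)
    finally show "2 * ((u s - v s) \<bullet> (f (u s) - f (v s))) \<le> 2 * L * (q s - 0)"
      by (simp add: q_def power2_norm_eq_inner[symmetric] power2_eq_square algebra_simps)
  qed
  then have "(dist (u t) (v t))\<^sup>2 \<le> (exp (L * t) * dist x y)\<^sup>2"
    using u v by (simp add: q_def ode_solution_def dist_norm power2_norm_eq_inner[symmetric]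
        power_mult_distrib exp_double[symmetric] mult.assoc)
  then show ?thesis
    by (rule power2_le_imp_le) simp
qed

lemma locally_lipschitz_on_compact:
  assumes "locally_lipschitz f" "compact C"
  obtains L where "L-lipschitz_on C f"
proof -
  have "local_lipschitz (UNIV :: real set) C (\<lambda>_. f)"
    using assms(1) unfolding locally_lipschitz_def by (rule local_lipschitz_subset) auto
  then have l: "local_lipschitz {0::real} C (\<lambda>_. f)"
    by (rule local_lipschitz_subset) auto
  show ?thesis
    by (rule local_lipschitz_compact_implies_lipschitz[OF l assms(2)]) (auto intro: that)
qed

lemma locally_lipschitz_continuous_on:
  assumes "locally_lipschitz f" shows "continuous_on S f"
  using local_lipschitz_continuous_on[OF assms[unfolded locally_lipschitz_def], of 0]
  by (auto intro: continuous_on_subset)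

text \<open>Both ranges lie in one compact set, so a single Lipschitz constant serves, and Gronwall
  starts from distance 0.\<close>

lemma ode_solution_unique:
  assumes f: "locally_lipschitz f" and u: "ode_solution f x T u" and v: "ode_solution f x T v"
    and t: "t \<in> {0..T}"
  shows "u t = v t"
proof -
  have "compact (u ` {0..T} \<union> v ` {0..T})"
    by (intro compact_Un compact_continuous_image ode_solution_continuous_on[OF u]
        ode_solution_continuous_on[OF v]) auto
  then obtain L where "L-lipschitz_on (u ` {0..T} \<union> v ` {0..T}) f"
    using locally_lipschitz_on_compact[OF f] by blast
  from gronwall_ode[OF u v this _ t] show ?thesis by auto
qed

lemma flow_eq:
  assumes f: "locally_lipschitz f" and y: "ode_solution f x T y" and t: "t \<in> {0..T}"
  shows "flow f t x = y t"
  unfolding flow_def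
proof (rule the_equality)
  have yt: "ode_solution f x t y" using ode_solution_restrict[OF y] t by simp
  then show "\<exists>z. ode_solution f x t z \<and> z t = y t" by blast
  show "p = y t" if "\<exists>z. ode_solution f x t z \<and> z t = p" for p
    using that ode_solution_unique[OF f _ yt] t by force
qed

text \<open>\<open>flow\<close> chooses its value separately for each time, from solutions on
  different intervals. Uniqueness identifies them all with one solution on \<open>{0..T}\<close>, so
  the values fit together to a trajectory.\<close>

lemma ode_solution_flow:
  assumes f: "locally_lipschitz f" and x: "global_forward f x" and T: "0 \<le> T"
  shows "ode_solution f x T (\<lambda>t. flow f t x)"
proof -
  obtain y where y: "ode_solution f x T y" using x T by (auto simp: global_forward_def)
  have eq: "flow f t x = y t" if "t \<in> {0..T}" for t
    using flow_eq[OF f y that] .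
  have "((\<lambda>t. flow f t x) has_vector_derivative f (flow f t x)) (at t within {0..T})"
    if t: "t \<in> {0..T}" for t
  proof (rule has_vector_derivative_transform[OF t])
    show "flow f s x = y s" if "s \<in> {0..T}" for s using eq[OF that] .
    show "(y has_vector_derivative f (flow f t x)) (at t within {0..T})"
      using y t by (simp add: eq ode_solution_def)
  qed
  then show ?thesis
    using eq[of 0] y T by (auto simp: ode_solution_def)
qed

lemma flow_0: "locally_lipschitz f \<Longrightarrow> global_forward f x \<Longrightarrow> flow f 0 x = x"
  using ode_solution_flow[of f x 0] by (simp add: ode_solution_def)

lemma continuous_on_flow:
  assumes "locally_lipschitz f" "global_forward f x"
  shows "continuous_on {0..T} (\<lambda>t. flow f t x)"
  using ode_solution_continuous_on[OF ode_solution_flow[OF assms, of T]]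
  by (cases "0 \<le> T") auto

lemma flow_deriv:
  assumes "locally_lipschitz f" "global_forward f x" "0 < t"
  shows "((\<lambda>t. flow f t x) has_vector_derivative f (flow f t x)) (at t)"
  using ode_solution_deriv_at[OF ode_solution_flow[OF assms(1,2)], of "t + 1" t] assms(3) by simp

lemma
  assumes f: "locally_lipschitz f" and x: "global_forward f x" and a: "0 \<le> a"
  shows global_forward_flow: "global_forward f (flow f a x)"
    and flow_add: "\<And>t. 0 \<le> t \<Longrightarrow> flow f t (flow f a x) = flow f (a + t) x"
proof -
  have sol: "ode_solution f (flow f a x) T (\<lambda>t. flow f (a + t) x)" if "0 \<le> T" for T
    by (intro ode_solution_shift[OF ode_solution_flow[OF f x] a]) (use a that in auto)
  then show "global_forward f (flow f a x)"
    unfolding global_forward_def by blast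
  show "flow f t (flow f a x) = flow f (a + t) x" if "0 \<le> t" for t
    using flow_eq[OF f sol[OF that]] that by simp
qed

text \<open>A solution starting close enough to \<open>x\<close> stays in the unit tube around the orbit of \<open>x\<close>,
  because Gronwall rules out a first time at which it would touch the boundary of the tube.\<close>

lemma flow_near_orbit:
  assumes f: "locally_lipschitz f" and x: "global_forward f x" and T: "0 \<le> T"
  obtains d L where "0 < d"
    "\<And>y t. dist x y < d \<Longrightarrow> global_forward f y \<Longrightarrow> t \<in> {0..T} \<Longrightarrow>
       dist (flow f t x) (flow f t y) \<le> exp (L * t) * dist x y \<and> dist (flow f t x) (flow f t y) \<le> 1"
proof -
  have "compact ((\<lambda>t. flow f t x) ` {0..T})"
    by (intro compact_continuous_image continuous_on_flow[OF f x]) auto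
  then obtain R where R: "\<And>t. t \<in> {0..T} \<Longrightarrow> norm (flow f t x) \<le> R"
    by (meson bounded_iff compact_imp_bounded imageI)
  obtain L where L: "L-lipschitz_on (cball 0 (R + 1)) f"
    using locally_lipschitz_on_compact[OF f] compact_cball by blast
  have L0: "0 \<le> L" using L by (rule lipschitz_on_nonneg)
  \<comment> \<open>This radius cancels the largest Gronwall growth on \<open>{0..T}\<close>, so the
    estimate stays strictly below the tube radius 1.\<close>
  define d where "d = exp (- (L * T))"
  have main: "dist (flow f t x) (flow f t y) \<le> exp (L * t) * dist x y \<and> dist (flow f t x) (flow f t y) \<le> 1"
    if y: "global_forward f y" and d: "dist x y < d" and t: "t \<in> {0..T}" for y t
  proof -
    define g where "g s = dist (flow f s x) (flow f s y)" for s
    have cont: "continuous_on {0..T} g"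
      unfolding g_def by (intro continuous_intros continuous_on_flow f x y)
    have tube: "g s \<le> exp (L * s) * dist x y"
      if S: "S \<in> {0..T}" and s: "s \<in> {0..S}" and le: "\<And>r. r \<in> {0..S} \<Longrightarrow> g r \<le> 1" for S s
      unfolding g_def
    proof (rule gronwall_ode[OF ode_solution_flow[OF f x] ode_solution_flow[OF f y] L _ s])
      fix r assume r: "r \<in> {0..S}"
      then have "norm (flow f r x) \<le> R" using R S by auto
      moreover have "norm (flow f r y) \<le> norm (flow f r x) + g r"
        unfolding g_def dist_norm by norm
      ultimately show "flow f r x \<in> cball 0 (R + 1) \<and> flow f r y \<in> cball 0 (R + 1)"
        using le[OF r] by simp
    qed (use S in auto)
    have small: "exp (L * s) * dist x y < 1" if "s \<in> {0..T}" for s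
    proof -
      have "exp (L * s) * dist x y \<le> exp (L * T) * dist x y"
        using that L0 by (intro mult_right_mono) (auto intro: mult_left_mono)
      also have "\<dots> < exp (L * T) * d" using d by simp
      finally show ?thesis by (simp add: d_def exp_minus)
    qed
    have "g s < 1" if "s \<in> {0..T}" for s
    proof (rule ccontr)
      assume s: "\<not> g s < 1"
      have g0: "g 0 < 1"
        using small[of 0] T by (simp add: g_def flow_0 f x y)
      have "compact ({0..T} \<inter> g -` {1..})"
        unfolding compact_eq_bounded_closed
        by (intro conjI continuous_closed_preimage[OF cont]) (auto intro: bounded_subset[of "{0..T}"])
      moreover have "{0..T} \<inter> g -` {1..} \<noteq> {}"
        using that s by auto
      ultimately obtain m where "m \<in> {0..T} \<inter> g -` {1..}"
        "\<forall>r\<in>{0..T} \<inter> g -` {1..}. m \<le> r"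
        using compact_attains_inf by blast
      then have m: "m \<in> {0..T}" "1 \<le> g m"
        "\<And>r. r \<in> {0..T} \<Longrightarrow> 1 \<le> g r \<Longrightarrow> m \<le> r"
        by auto
      \<comment> \<open>The intermediate value theorem and the minimality of \<open>m\<close> give
        \<open>g m\<close> exactly 1. The tube estimate thus applies up to \<open>m\<close> itself,
        where its strict bound contradicts \<open>1 \<le> g m\<close>.\<close>
      obtain r where r: "0 \<le> r" "r \<le> m" "g r = 1"
        using IVT'[of g 0 1 m] g0 m continuous_on_subset[OF cont, of "{0..m}"] by auto
      then have "r = m" using m(3)[of r] m(1) by auto
      have "g q \<le> 1" if "q \<in> {0..m}" for q
        using that m(1) m(3)[of q] r(3) \<open>r = m\<close> by (cases "q = m") force+
      then have "g m \<le> exp (L * m) * dist x y"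
        by (intro tube[of m]) (use m in auto)
      with small[OF m(1)] m(2) show False by simp
    qed
    then have "g s \<le> 1" if "s \<in> {0..T}" for s using that by force
    then show ?thesis using tube[of T t] T t by (auto simp: g_def)
  qed
  show ?thesis
    by (rule that[of d L]) (use main in \<open>auto simp: d_def\<close>)
qed

subsection \<open>Gradients and sublevel sets\<close>

lemma gradient_eq: "GDERIV J x :> D \<Longrightarrow> gradient J x = D"
  unfolding gradient_def
proof (rule the_equality)
  fix D' assume D: "GDERIV J x :> D" and D': "GDERIV J x :> D'"
  then have "(\<lambda>h. h \<bullet> D') = (\<lambda>h. h \<bullet> D)"
    unfolding gderiv_def by (intro has_derivative_unique)
  then have "\<forall>h. D' \<bullet> h = D \<bullet> h"
    by (metis inner_commute)
  then show "D' = D" by (simp only: vector_eq_rdot)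
qed

lemma gderiv_has_derivative:
  fixes J :: "real^'n \<Rightarrow> real"
  assumes J': "(J has_derivative J') (at x)"
  shows "GDERIV J x :> (\<Sum>b\<in>Basis. J' b *\<^sub>R b)"
proof -
  have lin: "linear J'" using J' by (rule has_derivative_linear)
  have "J' h = h \<bullet> (\<Sum>b\<in>Basis. J' b *\<^sub>R b)" for h
  proof -
    have "J' h = J' (\<Sum>b\<in>Basis. (h \<bullet> b) *\<^sub>R b)" by (simp add: euclidean_representation)
    also have "\<dots> = (\<Sum>b\<in>Basis. (h \<bullet> b) * J' b)"
      by (simp add: linear_sum[OF lin] linear_scale[OF lin] o_def)
    finally show ?thesis by (simp add: inner_sum_right mult.commute)
  qed
  then show ?thesis
    unfolding gderiv_def by (rule has_derivative_eq_rhs[OF J' ext])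
qed

lemma C1_gderiv:
  assumes "C1 J" shows "GDERIV J x :> gradient J x"
proof -
  obtain J' where "(J has_derivative J') (at x)"
    using assms by (auto simp: C1_def differentiable_on_def differentiable_def)
  from gderiv_has_derivative[OF this] show ?thesis by (simp add: gradient_eq)
qed

lemma C1_continuous_on: "C1 J \<Longrightarrow> continuous_on S J"
  unfolding C1_def by (meson continuous_on_subset differentiable_imp_continuous_on subset_UNIV)

lemma feasible_decay:
  assumes f: "locally_lipschitz f" and feas: "(w, J, \<epsilon>) \<in> feasible f X"
    and z: "global_forward f z" and t: "0 \<le> t"
    and X: "\<And>s. s \<in> {0..t} \<Longrightarrow> flow f s z \<in> X"
  shows "J (flow f t z) - \<epsilon> \<le> exp (- t) * (J z - \<epsilon>)"
proof -
  have J: "C1 J" using feas by (simp add: feasible_def)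
  define q where "q s = J (flow f s z)" for s
  have "q t - \<epsilon> \<le> exp ((- 1) * t) * (q 0 - \<epsilon>)"
  proof (rule gronwall_differential[OF t])
    show "continuous_on {0..t} q"
      unfolding q_def
      by (rule continuous_on_compose2[OF C1_continuous_on[OF J, of UNIV] continuous_on_flow[OF f z]]) auto
  next
    fix s assume s: "0 < s" "s < t"
    have "(q has_derivative (\<lambda>h. (h *\<^sub>R f (flow f s z)) \<bullet> gradient J (flow f s z))) (at s)"
      unfolding q_def
      by (rule has_derivative_compose[OF flow_deriv[OF f z s(1), unfolded has_vector_derivative_def]])
         (use C1_gderiv[OF J] in \<open>simp add: gderiv_def\<close>)
    then show "(q has_real_derivative gradient J (flow f s z) \<bullet> f (flow f s z)) (at s)"
      unfolding has_field_derivative_def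
      by (rule has_derivative_eq_rhs) (simp add: fun_eq_iff inner_commute mult.commute)
    have "flow f s z \<in> X" using X s by simp
    then show "gradient J (flow f s z) \<bullet> f (flow f s z) \<le> (- 1) * (q s - \<epsilon>)"
      using feas by (force simp: feasible_def q_def)
  qed
  then show ?thesis by (simp add: q_def flow_0[OF f z])
qed

text \<open>Suppose the last time \<open>m\<close> in \<open>{0..t}\<close> with \<open>J\<close> in
  \<open>{0..\<epsilon>}\<close> came before \<open>t\<close>. The point reached at \<open>m\<close>
  is interior to \<open>X\<close>, so the orbit remains in \<open>X\<close> a little longer, and
  there feasibility gives both bounds on \<open>J\<close>: decay the upper one,
  \<open>0 \<le> J\<close> the lower one. \<open>I\<close> may have gaps, as only its maximum is
  used.\<close>

lemma positively_invariant_sublevel: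
  assumes f: "locally_lipschitz f" and X: "compact X" "\<And>x. x \<in> X \<Longrightarrow> global_forward f x"
    and feas: "(w, J, \<epsilon>) \<in> feasible f X" and S: "J -` {0..\<epsilon>} \<subseteq> interior X"
  shows "positively_invariant f (J -` {0..\<epsilon>})"
  unfolding positively_invariant_def
proof (intro ballI conjI allI impI)
  fix x assume x: "x \<in> J -` {0..\<epsilon>}"
  then have "x \<in> X" using S interior_subset by blast
  then show gx: "global_forward f x" by (rule X(2))
  fix t :: real assume t: "0 \<le> t"
  define I where "I = {0..t} \<inter> (\<lambda>s. J (flow f s x)) -` {0..\<epsilon>}"
  have J: "C1 J" using feas by (simp add: feasible_def)
  have cont: "continuous_on {0..t} (\<lambda>s. J (flow f s x))"
    by (rule continuous_on_compose2[OF C1_continuous_on[OF J, of UNIV] continuous_on_flow[OF f gx]]) auto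
  have "compact I"
    unfolding compact_eq_bounded_closed I_def
    by (intro conjI continuous_closed_preimage[OF cont]) (auto intro: bounded_subset[of "{0..t}"])
  moreover have "0 \<in> I" using x t by (simp add: I_def flow_0[OF f gx])
  ultimately obtain m where m: "m \<in> I" "\<And>s. s \<in> I \<Longrightarrow> s \<le> m"
    using compact_attains_sup[of I] by blast
  have "m = t"
  proof (rule ccontr)
    assume "m \<noteq> t"
    then have mt: "0 \<le> m" "m < t" using m(1) by (auto simp: I_def)
    define z where "z = flow f m x"
    have gz: "global_forward f z" unfolding z_def by (rule global_forward_flow[OF f gx mt(1)])
    have z: "z \<in> J -` {0..\<epsilon>}" using m(1) by (simp add: I_def z_def)
    obtain e where e: "0 < e" "ball z e \<subseteq> X"
      using z S unfolding subset_iff mem_interior by blast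
    have "\<exists>d>0. \<forall>s\<in>{0..t - m}. dist s 0 < d \<longrightarrow> dist (flow f s z) (flow f 0 z) < e"
    proof -
      have "0 \<in> {0..t - m}" using mt by simp
      with continuous_on_flow[OF f gz, of "t - m"] e(1) show ?thesis
        unfolding continuous_on_iff by blast
    qed
    then obtain d where d: "0 < d" "\<And>s. s \<in> {0..t - m} \<Longrightarrow> s < d \<Longrightarrow> dist (flow f s z) z < e"
      by (force simp: flow_0[OF f gz])
    define h where "h = min (d / 2) (t - m)"
    have h: "0 < h" "h < d" "h \<le> t - m" using d mt by (auto simp: h_def)
    have inX: "flow f s z \<in> X" if "s \<in> {0..h}" for s
      using d(2)[of s] that h e(2) by (auto simp: subset_iff dist_commute)
    have "J (flow f h z) - \<epsilon> \<le> exp (- h) * (J z - \<epsilon>)"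
      by (rule feasible_decay[OF f feas gz _ inX]) (use h in auto)
    also have "\<dots> \<le> 0" using z by (simp add: mult_le_0_iff)
    finally have "J (flow f h z) \<le> \<epsilon>" by simp
    moreover have "0 \<le> J (flow f h z)"
      using inX[of h] h feas by (auto simp: feasible_def)
    moreover have "flow f h z = flow f (m + h) x"
      unfolding z_def using flow_add[OF f gx mt(1), of h] h by simp
    ultimately have "m + h \<in> I" using mt h by (simp add: I_def)
    then show False using m(2)[of "m + h"] h by simp
  qed
  then show "flow f t x \<in> J -` {0..\<epsilon>}" using m(1) by (simp add: I_def)
qed

subsection \<open>Attractors and their basins\<close>

lemma bounded_infdist_le:
  fixes A :: "'a::heine_borel set"
  assumes "A \<noteq> {}" "compact A"
  shows "bounded {x. infdist x A \<le> r}"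
proof -
  have "compact {x. infdist x A \<le> max r 1}" using compact_infdist_le[OF assms] by simp
  then show ?thesis by (rule bounded_subset[OF compact_imp_bounded]) auto
qed

text \<open>Stability turns pointwise attraction into locally uniform attraction. At time
  \<open>T\<close> the orbit of \<open>x\<close> is \<open>\<delta> / 2\<close>-close to
  \<open>A\<close>; orbits from near \<open>x\<close> are then \<open>\<delta>\<close>-close by
  continuous dependence, and stability keeps them \<open>r\<close>-close from that time on. Before
  \<open>T\<close> they stay within 1 of the orbit of \<open>x\<close>, hence bounded.\<close>

lemma basin_point_uniform:
  fixes A :: "(real^'n) set"
  assumes f: "locally_lipschitz f" and A: "A \<noteq> {}" "compact A" and st: "asymptotically_stable f A"
    and x: "x \<in> basin f A" and r: "0 < r"
  obtains d T R where "0 < d" "0 \<le> T"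
    "\<And>y t. y \<in> ball x d \<Longrightarrow> 0 \<le> t \<Longrightarrow> norm (flow f t y) \<le> R"
    "\<And>y t. y \<in> ball x d \<Longrightarrow> T \<le> t \<Longrightarrow> infdist (flow f t y) A < r"
proof -
  have gx: "global_forward f x" using x by (simp add: basin_def)
  have "stable f A" using st by (simp add: asymptotically_stable_def)
  then obtain \<delta> where \<delta>: "0 < \<delta>" "\<And>y t. infdist y A < \<delta> \<Longrightarrow> 0 \<le> t \<Longrightarrow> infdist (flow f t y) A < r"
    using r unfolding stable_def by meson
  have "((\<lambda>t. infdist (flow f t x) A) \<longlongrightarrow> 0) at_top"
    using x by (simp add: basin_def)
  then have "\<forall>\<^sub>F t in at_top. infdist (flow f t x) A < \<delta> / 2"
    using \<delta>(1) by (auto dest: order_tendstoD(2)[of _ _ _ "\<delta> / 2"])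
  then obtain T0 where "\<forall>t\<ge>T0. infdist (flow f t x) A < \<delta> / 2"
    unfolding eventually_at_top_linorder by blast
  then obtain T where T: "0 \<le> T" "infdist (flow f T x) A < \<delta> / 2"
    using that[of "max 0 T0"] by simp
  obtain d0 L where d0: "0 < d0"
    and near: "\<And>y t. dist x y < d0 \<Longrightarrow> global_forward f y \<Longrightarrow> t \<in> {0..T} \<Longrightarrow>
       dist (flow f t x) (flow f t y) \<le> exp (L * t) * dist x y \<and> dist (flow f t x) (flow f t y) \<le> 1"
    using flow_near_orbit[OF f gx T(1)] by blast
  have "open (basin f A)" using st by (simp add: asymptotically_stable_def)
  then obtain d1 where d1: "0 < d1" "ball x d1 \<subseteq> basin f A"
    using x open_contains_ball by blast
  define d where "d = min (min d0 d1) (\<delta> / 2 * exp (- (L * T)))"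
  have "bounded ((\<lambda>t. flow f t x) ` {0..T} \<union> {x. infdist x A \<le> r})"
    by (intro bounded_Un[THEN iffD2] conjI compact_imp_bounded compact_continuous_image
        continuous_on_flow f gx bounded_infdist_le A) auto
  then obtain R where "\<And>y. y \<in> (\<lambda>t. flow f t x) ` {0..T} \<union> {x. infdist x A \<le> r} \<Longrightarrow> norm y \<le> R"
    unfolding bounded_iff by blast
  then have R: "\<And>t. t \<in> {0..T} \<Longrightarrow> norm (flow f t x) \<le> R"
      "\<And>y. infdist y A \<le> r \<Longrightarrow> norm y \<le> R"
    by blast+
  have late: "infdist (flow f t y) A < r" if y: "y \<in> ball x d" and t: "T \<le> t" for y t
  proof -
    have gy: "global_forward f y" using y d1 by (auto simp: d_def basin_def)
    have "dist (flow f T x) (flow f T y) \<le> exp (L * T) * dist x y"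
      using near[of y T] y gy T by (auto simp: d_def)
    also have "\<dots> < exp (L * T) * (\<delta> / 2 * exp (- (L * T)))"
      using y by (simp add: d_def)
    also have "\<dots> = \<delta> / 2" by (simp add: exp_minus)
    finally have "infdist (flow f T y) A < \<delta>"
      using T(2) infdist_triangle[of "flow f T y" A "flow f T x"] by (simp add: dist_commute)
    then have "infdist (flow f (t - T) (flow f T y)) A < r" using \<delta>(2) t by simp
    then show ?thesis using flow_add[OF f gy T(1), of "t - T"] t by simp
  qed
  show ?thesis
  proof (rule that[of d T "R + 1"])
    show "0 < d" using d0 d1 \<delta> by (simp add: d_def)
    fix y :: "real^'n" assume y: "y \<in> ball x d"
    fix t :: real assume t: "0 \<le> t"
    show "norm (flow f t y) \<le> R + 1"
    proof (cases "t \<le> T")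
      case True
      have gy: "global_forward f y" using y d1 by (auto simp: d_def basin_def)
      have "dist (flow f t x) (flow f t y) \<le> 1"
        using near[of y t] y gy True t by (auto simp: d_def)
      moreover have "norm (flow f t x) \<le> R" using R(1) True t by simp
      ultimately show ?thesis
        using norm_triangle_sub[of "flow f t y" "flow f t x"] by (simp add: dist_norm norm_minus_commute)
    next
      case False
      then have "infdist (flow f t y) A \<le> r" using late[OF y, of t] by simp
      then show ?thesis using R(2)[of "flow f t y"] by simp
    qed
  qed (use T late in auto)
qed

lemma basin_compact_uniform:
  fixes A :: "(real^'n) set"
  assumes f: "locally_lipschitz f" and A: "A \<noteq> {}" "compact A" and st: "asymptotically_stable f A"
    and N: "compact N" "N \<subseteq> basin f A" and r: "0 < r"
  obtains T R where "0 \<le> T"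
    "\<And>y t. y \<in> N \<Longrightarrow> 0 \<le> t \<Longrightarrow> norm (flow f t y) \<le> R"
    "\<And>y t. y \<in> N \<Longrightarrow> T \<le> t \<Longrightarrow> infdist (flow f t y) A < r"
proof -
  have "\<exists>d T R. 0 < d \<and> 0 \<le> T \<and> (\<forall>y t. y \<in> ball x d \<longrightarrow> 0 \<le> t \<longrightarrow> norm (flow f t y) \<le> R) \<and>
    (\<forall>y t. y \<in> ball x d \<longrightarrow> T \<le> t \<longrightarrow> infdist (flow f t y) A < r)" if "x \<in> N" for x
  proof -
    have x: "x \<in> basin f A" using N(2) that by blast
    show ?thesis by (rule basin_point_uniform[OF f A st x r]) blast
  qed
  then obtain d T R where d: "\<And>x. x \<in> N \<Longrightarrow> 0 < d x"
    and R: "\<And>x y t. x \<in> N \<Longrightarrow> y \<in> ball x (d x) \<Longrightarrow> 0 \<le> t \<Longrightarrow> norm (flow f t y) \<le> R x"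
    and T: "\<And>x y t. x \<in> N \<Longrightarrow> y \<in> ball x (d x) \<Longrightarrow> T x \<le> t \<Longrightarrow> infdist (flow f t y) A < r"
    by metis
  have "N \<subseteq> (\<Union>x\<in>N. ball x (d x))" using d by force
  then obtain C where C: "C \<subseteq> N" "finite C" "N \<subseteq> (\<Union>x\<in>C. ball x (d x))"
    using compactE_image[OF N(1), of N "\<lambda>x. ball x (d x)"] by blast
  \<comment> \<open>\<open>insert 0\<close> gives \<open>Max\<close> a non-empty set even when
    \<open>N\<close> is empty, and makes \<open>T'\<close> nonnegative.\<close>
  define T' where "T' = Max (insert 0 (T ` C))"
  define R' where "R' = Max (insert 0 (R ` C))"
  have le: "T x \<le> T'" "R x \<le> R'" if "x \<in> C" for x
    using that C(2) by (auto simp: T'_def R'_def)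
  show ?thesis
  proof (rule that[of T' R'])
    show "0 \<le> T'" using C(2) by (simp add: T'_def)
    fix y t assume y: "y \<in> N"
    then obtain x where x: "x \<in> C" "y \<in> ball x (d x)" using C(3) by blast
    show "norm (flow f t y) \<le> R'" if "0 \<le> t"
      using R[OF _ x(2) that] le(2)[OF x(1)] C(1) x(1) by force
    show "infdist (flow f t y) A < r" if "T' \<le> t"
      using T[OF _ x(2), of t] le(1)[OF x(1)] that C(1) x(1) by force
  qed
qed

lemma flow_lipschitz:
  assumes f: "locally_lipschitz f" and L: "L-lipschitz_on S f"
    and x: "global_forward f x" "\<And>t. 0 \<le> t \<Longrightarrow> flow f t x \<in> S"
    and y: "global_forward f y" "\<And>t. 0 \<le> t \<Longrightarrow> flow f t y \<in> S" and t: "0 \<le> t"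
  shows "dist (flow f t x) (flow f t y) \<le> exp (L * t) * dist x y"
  by (rule gronwall_ode[OF ode_solution_flow[OF f x(1) t] ode_solution_flow[OF f y(1) t] L])
     (use x y t in auto)

text \<open>The setting of the later estimates: on a closed neighbourhood of \<open>X\<close>,
  orbits are global and remain in one ball, so the time-\<open>t\<close> map has Lipschitz constant
  \<open>exp (L * t)\<close> there. The margin \<open>s\<close> leaves room for perturbed initial
  points, averaging balls and Euler steps, all of which may leave \<open>X\<close>.\<close>

lemma stable_compact_attractor_neighbourhood:
  assumes f: "locally_lipschitz f" and X: "compact X" and sca: "stable_compact_attractor f X A"
  obtains s L R where "0 < s" "L-lipschitz_on (cball 0 R) f"
    "\<And>x. infdist x X \<le> s \<Longrightarrow> x \<in> basin f A"
    "\<And>x t. infdist x X \<le> s \<Longrightarrow> 0 \<le> t \<Longrightarrow> flow f t x \<in> cball 0 R"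
proof -
  from sca have A: "A \<noteq> {}" "compact A" "A \<subseteq> X" and st: "asymptotically_stable f A"
    and XB: "X \<subseteq> basin f A" by (auto simp: stable_compact_attractor_def)
  have X0: "X \<noteq> {}" using A by auto
  have "open (basin f A)" using st by (simp add: asymptotically_stable_def)
  then obtain s where s: "0 < s" "{x. infdist x X \<le> s} \<subseteq> basin f A"
    using compact_in_open_separated[OF X0 X] XB by metis
  obtain T R where R: "\<And>y t. y \<in> {x. infdist x X \<le> s} \<Longrightarrow> 0 \<le> t \<Longrightarrow> norm (flow f t y) \<le> R"
    by (rule basin_compact_uniform[OF f A(1,2) st compact_infdist_le[OF X0 X s(1)] s(2) zero_less_one]) blast
  obtain L where "L-lipschitz_on (cball 0 R) f"
    using locally_lipschitz_on_compact[OF f] compact_cball by blast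
  with s R show ?thesis by (intro that[of s L R]) auto
qed

text \<open>Past time \<open>\<tau>\<close> an orbit near \<open>A\<close> is the image under the time-\<open>\<tau>\<close> map of an orbit near
  \<open>A\<close>, so the Lipschitz continuity of that map transfers attraction and stability from \<open>A\<close> to its
  image.\<close>

lemma stable_compact_attractor_flow_image:
  assumes f: "locally_lipschitz f" and X: "compact X" and sca: "stable_compact_attractor f X A"
    and \<tau>: "0 \<le> \<tau>"
  shows "stable_compact_attractor f X (flow f \<tau> ` A)"
proof -
  define B where "B = flow f \<tau> ` A"
  from sca have A: "A \<noteq> {}" "compact A" "A \<subseteq> X" and st: "asymptotically_stable f A"
    and XB: "X \<subseteq> basin f A" and inv: "positively_invariant f A"
    by (auto simp: stable_compact_attractor_def)
  obtain s L R where s: "0 < s" and L: "L-lipschitz_on (cball 0 R) f"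
    and basin: "\<And>x. infdist x X \<le> s \<Longrightarrow> x \<in> basin f A"
    and R: "\<And>x t. infdist x X \<le> s \<Longrightarrow> 0 \<le> t \<Longrightarrow> flow f t x \<in> cball 0 R"
    by (rule stable_compact_attractor_neighbourhood[OF f X sca]) (rule that)
  have L0: "0 \<le> L" using L by (rule lipschitz_on_nonneg)
  have near: "infdist x X \<le> s" if "infdist x A \<le> s" for x
    using infdist_mono[OF A(3,1), of x] that by simp
  have lip: "dist (flow f t x) (flow f t y) \<le> exp (L * t) * dist x y"
    if "infdist x A \<le> s" "infdist y A \<le> s" "0 \<le> t" for x y t
    using that near by (intro flow_lipschitz[OF f L]) (use basin R in \<open>auto simp: basin_def\<close>)
  have A0: "infdist a A \<le> s" if "a \<in> A" for a using that s by simp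
  have "B \<noteq> {}" using A by (simp add: B_def)
  have "compact B" unfolding B_def
  proof (rule compact_continuous_image[OF lipschitz_on_continuous_on A(2)])
    show "(exp (L * \<tau>))-lipschitz_on A (flow f \<tau>)"
      by (rule lipschitz_onI) (use lip A0 \<tau> in auto)
  qed
  have BA: "B \<subseteq> A" using inv \<tau> by (auto simp: B_def positively_invariant_def)
  have gA: "global_forward f a" if "a \<in> A" for a using inv that by (auto simp: positively_invariant_def)
  have invA: "flow f t a \<in> A" if "a \<in> A" "0 \<le> t" for a t using inv that by (auto simp: positively_invariant_def)
  have invB: "flow f t b \<in> B" if b: "b \<in> B" and t: "0 \<le> t" for b t
  proof -
    obtain a where a: "a \<in> A" "b = flow f \<tau> a" using b by (auto simp: B_def)
    have "flow f t b = flow f \<tau> (flow f t a)"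
      using flow_add[OF f gA[OF a(1)]] a(2) \<tau> t by (simp add: add.commute)
    then show ?thesis using invA[OF a(1) t] by (simp add: B_def)
  qed
  have key: "infdist (flow f t x) B \<le> exp (L * \<tau>) * infdist (flow f (t - \<tau>) x) A"
    if x: "global_forward f x" and t: "\<tau> \<le> t" and le: "infdist (flow f (t - \<tau>) x) A \<le> s" for x t
  proof -
    define y where "y = flow f (t - \<tau>) x"
    obtain a where a: "a \<in> A" "infdist y A = dist y a"
      using infdist_attains_inf[OF compact_imp_closed[OF A(2)] A(1)] by blast
    have "flow f t x = flow f \<tau> y"
      unfolding y_def using flow_add[OF f x, of "t - \<tau>" \<tau>] t \<tau> by simp
    then have "infdist (flow f t x) B \<le> dist (flow f \<tau> y) (flow f \<tau> a)"
      using a(1) by (simp add: B_def infdist_le)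
    also have "\<dots> \<le> exp (L * \<tau>) * dist y a"
      by (rule lip) (use le a(1) A0 \<tau> in \<open>auto simp: y_def\<close>)
    finally show ?thesis using a(2) by (simp add: y_def)
  qed
  have "basin f A = basin f B"
  proof (intro equalityI subsetI)
    fix x assume x: "x \<in> basin f B"
    have "((\<lambda>t. infdist (flow f t x) A) \<longlongrightarrow> 0) at_top"
    proof (rule tendsto_sandwich[where f = "\<lambda>_. 0" and h = "\<lambda>t. infdist (flow f t x) B"])
      show "\<forall>\<^sub>F t in at_top. infdist (flow f t x) A \<le> infdist (flow f t x) B"
        using infdist_mono[OF BA \<open>B \<noteq> {}\<close>] by (intro always_eventually) auto
    qed (use x in \<open>auto simp: basin_def infdist_nonneg\<close>)
    then show "x \<in> basin f A" using x by (simp add: basin_def)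
  next
    fix x assume x: "x \<in> basin f A"
    then have gx: "global_forward f x" and lim: "((\<lambda>t. infdist (flow f t x) A) \<longlongrightarrow> 0) at_top"
      by (auto simp: basin_def)
    have lim2: "((\<lambda>t. infdist (flow f (t - \<tau>) x) A) \<longlongrightarrow> 0) at_top"
      by (rule filterlim_compose[OF lim]) (use filterlim_tendsto_add_at_top[OF tendsto_const filterlim_ident, of "-\<tau>"] in simp)
    have "((\<lambda>t. infdist (flow f t x) B) \<longlongrightarrow> 0) at_top"
    proof (rule tendsto_sandwich[where f = "\<lambda>_. 0"])
      show "((\<lambda>t. exp (L * \<tau>) * infdist (flow f (t - \<tau>) x) A) \<longlongrightarrow> 0) at_top"
        using tendsto_mult_left[OF lim2] by simp
      show "\<forall>\<^sub>F t in at_top. infdist (flow f t x) B \<le> exp (L * \<tau>) * infdist (flow f (t - \<tau>) x) A"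
        using order_tendstoD(2)[OF lim2 s] eventually_ge_at_top[of \<tau>]
        by eventually_elim (rule key[OF gx], auto)
    qed (auto simp: infdist_nonneg)
    then show "x \<in> basin f B" using gx by (simp add: basin_def)
  qed
  moreover have "stable f B"
    unfolding stable_def
  proof (intro allI impI)
    fix \<epsilon> :: real assume \<epsilon>: "0 < \<epsilon>"
    \<comment> \<open>\<open>s\<close> keeps points where \<open>lip\<close> applies; the other term
      divides by the Lipschitz constant of the time-\<open>\<tau>\<close> map.\<close>
    define e where "e = min s (\<epsilon> * exp (- (L * \<tau>)))"
    have e: "0 < e" using s \<epsilon> by (simp add: e_def)
    have "stable f A" using st by (simp add: asymptotically_stable_def)
    then obtain \<delta> where \<delta>: "0 < \<delta>" "\<And>y. infdist y A < \<delta> \<Longrightarrow> global_forward f y"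
      "\<And>y t. infdist y A < \<delta> \<Longrightarrow> 0 \<le> t \<Longrightarrow> infdist (flow f t y) A < e"
      using e unfolding stable_def by meson
    have small: "exp (L * \<tau>) * r < \<epsilon>" if "r < e" for r
    proof -
      have "exp (L * \<tau>) * r < exp (L * \<tau>) * (\<epsilon> * exp (- (L * \<tau>)))"
        using that unfolding e_def by (intro mult_strict_left_mono) auto
      also have "\<dots> = \<epsilon>" by (simp add: exp_minus)
      finally show ?thesis .
    qed
    show "\<exists>\<delta>>0. \<forall>y. infdist y B < \<delta> \<longrightarrow> global_forward f y \<and> (\<forall>t\<ge>0. infdist (flow f t y) B < \<epsilon>)"
    proof (intro exI[of _ "min \<delta> e"] conjI allI impI)
      show "0 < min \<delta> e" using \<delta> e by simp
      fix y assume y: "infdist y B < min \<delta> e"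
      then have yA: "infdist y A < \<delta>" "infdist y A < e"
        using infdist_mono[OF BA \<open>B \<noteq> {}\<close>, of y] by auto
      show gy: "global_forward f y" using \<delta>(2) yA by simp
      fix t :: real assume t: "0 \<le> t"
      show "infdist (flow f t y) B < \<epsilon>"
      proof (cases "t \<le> \<tau>")
        case True
        \<comment> \<open>Up to time \<open>\<tau>\<close> the point need not be an image under the
          time-\<open>\<tau>\<close> map, so it is compared with the orbit of the nearest point of
          \<open>B\<close>, which stays in \<open>B\<close>.\<close>
        obtain b where b: "b \<in> B" "infdist y B = dist y b"
          using infdist_attains_inf[OF compact_imp_closed[OF \<open>compact B\<close>] \<open>B \<noteq> {}\<close>] by blast
        have "infdist (flow f t y) B \<le> dist (flow f t y) (flow f t b)"
          by (rule infdist_le[OF invB[OF b(1) t]])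
        also have "\<dots> \<le> exp (L * t) * dist y b"
          by (rule lip) (use yA t A0 b(1) BA in \<open>auto simp: e_def\<close>)
        also have "\<dots> \<le> exp (L * \<tau>) * dist y b"
          using True L0 by (intro mult_right_mono) (auto intro: mult_left_mono)
        also have "\<dots> < \<epsilon>" using small[of "dist y b"] y b(2) by simp
        finally show ?thesis .
      next
        case False
        then have *: "infdist (flow f (t - \<tau>) y) A < e" using \<delta>(3)[OF yA(1)] by simp
        show ?thesis
          using key[OF gy, of t] False * small[OF *] by (simp add: e_def)
      qed
    qed
  qed
  moreover have "positively_invariant f B"
    using invB BA gA by (auto simp: positively_invariant_def)
  ultimately show ?thesis
    using \<open>B \<noteq> {}\<close> \<open>compact B\<close> BA A(3) XB st
    unfolding B_def[symmetric] stable_compact_attractor_def asymptotically_stable_def by auto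
qed

lemma minimal_attractor_invariant:
  assumes f: "locally_lipschitz f" and X: "compact X" and A: "minimal_attractor f X A" and t: "0 \<le> t"
  shows "flow f t ` A = A"
proof -
  have sca: "stable_compact_attractor f X A" using A by (simp add: minimal_attractor_def)
  then have "flow f t ` A \<subseteq> A"
    using t by (auto simp: stable_compact_attractor_def positively_invariant_def)
  with stable_compact_attractor_flow_image[OF f X sca t] A show ?thesis
    by (auto simp: minimal_attractor_def)
qed

lemma minimal_attractor_subset_sublevel:
  assumes f: "locally_lipschitz f" and X: "compact X" and A: "minimal_attractor f X A"
    and feas: "(w, J, \<epsilon>) \<in> feasible f X"
  shows "A \<subseteq> J -` {0..\<epsilon>} \<inter> X"
proof
  fix x assume x: "x \<in> A"
  have sca: "stable_compact_attractor f X A" using A by (simp add: minimal_attractor_def)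
  then have cA: "compact A" "A \<subseteq> X" and inv: "positively_invariant f A"
    by (auto simp: stable_compact_attractor_def)
  have J: "C1 J" using feas by (simp add: feasible_def)
  have "bounded (J ` A)"
    by (intro compact_imp_bounded compact_continuous_image C1_continuous_on J cA)
  \<comment> \<open>The ancestor of \<open>x\<close> changes with the time it is traced back, so the
    bound on \<open>J\<close> has to be uniform over \<open>A\<close>.\<close>
  then obtain M where M: "\<And>z. z \<in> A \<Longrightarrow> J z \<le> M"
    by (auto simp: bounded_real abs_le_iff)
  have decay: "J x \<le> \<epsilon> + exp (- t) * (M - \<epsilon>)" if t: "0 \<le> t" for t
  proof -
    obtain z where z: "z \<in> A" "x = flow f t z"
      using minimal_attractor_invariant[OF f X A t] x by blast
    have "J x - \<epsilon> \<le> exp (- t) * (J z - \<epsilon>)"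
      unfolding z(2)
      by (rule feasible_decay[OF f feas _ t])
         (use inv z(1) cA(2) in \<open>auto simp: positively_invariant_def\<close>)
    also have "\<dots> \<le> exp (- t) * (M - \<epsilon>)" using M[OF z(1)] by simp
    finally show ?thesis by simp
  qed
  have "((\<lambda>t. exp (- t)) \<longlongrightarrow> 0) (at_top :: real filter)"
    by (rule filterlim_compose[OF exp_at_bot filterlim_uminus_at_bot_at_top])
  then have "((\<lambda>t::real. \<epsilon> + exp (- t) * (M - \<epsilon>)) \<longlongrightarrow> \<epsilon> + 0 * (M - \<epsilon>)) at_top"
    by (intro tendsto_intros)
  then have "J x \<le> \<epsilon> + 0 * (M - \<epsilon>)"
    by (rule tendsto_lowerbound) (use decay in \<open>auto intro: eventually_mono[OF eventually_ge_at_top[of 0]]\<close>)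
  moreover have "0 \<le> J x" using feas x cA(2) by (auto simp: feasible_def)
  ultimately show "x \<in> J -` {0..\<epsilon>} \<inter> X" using x cA(2) by auto
qed

section \<open>The cost as a bound on the measure of the sublevel set\<close>

lemma compact_sublevel:
  assumes X: "compact X" and feas: "(w, J, \<epsilon>) \<in> feasible f X"
  shows "compact (J -` {0..\<epsilon>} \<inter> X)"
proof -
  have "continuous_on X J" using feas by (simp add: feasible_def C1_continuous_on)
  then have "closed (X \<inter> J -` {0..\<epsilon>})"
    by (intro continuous_closed_preimage compact_imp_closed X) auto
  then have "closed (J -` {0..\<epsilon>} \<inter> X)" by (simp add: Int_commute)
  then show ?thesis
    using compact_imp_bounded[OF X] by (auto simp: compact_eq_bounded_closed intro: bounded_subset)
qed

lemma continuous_on_compact_set_integrable: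
  fixes g :: "'a::euclidean_space \<Rightarrow> real"
  assumes "compact S" "continuous_on S g"
  shows "set_integrable lebesgue S g"
proof -
  have "integrable lborel (\<lambda>x. indicator S x *\<^sub>R g x)"
    by (rule borel_integrable_compact[OF assms])
  then show ?thesis
    unfolding set_integrable_def by (simp add: integrable_completion borel_measurable_integrable)
qed

lemma measure_sublevel_le_cost:
  assumes X: "compact X" and feas: "(w, J, \<epsilon>) \<in> feasible f X"
  shows "measure lebesgue (J -` {0..\<epsilon>} \<inter> X) \<le> cost X (w, J, \<epsilon>)"
proof -
  define K where "K = J -` {0..\<epsilon>} \<inter> X"
  have K: "K \<in> lmeasurable" unfolding K_def
    by (rule lmeasurable_compact[OF compact_sublevel[OF X feas]])
  have XL: "X \<in> lmeasurable" by (rule lmeasurable_compact[OF X])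
  have w: "set_integrable lebesgue X w"
    using feas by (intro continuous_on_compact_set_integrable X) (simp add: feasible_def)
  have e: "set_integrable lebesgue X (\<lambda>_. \<epsilon>)"
    by (intro continuous_on_compact_set_integrable X) simp
  have "measure lebesgue K = (LINT x|lebesgue. indicator K x)"
    using K by (simp add: fmeasurable_def)
  also have "\<dots> \<le> (LINT x:X|lebesgue. w x + \<epsilon>)"
    unfolding set_lebesgue_integral_def
  proof (rule integral_mono)
    show "integrable lebesgue (\<lambda>x. indicator K x :: real)"
      using K by (auto simp: fmeasurable_def intro: integrable_real_indicator)
    show "integrable lebesgue (\<lambda>x. indicator X x *\<^sub>R (w x + \<epsilon>))"
      using set_integral_add(1)[OF w e] by (simp add: set_integrable_def)
    show "indicator K x \<le> indicator X x *\<^sub>R (w x + \<epsilon>)" for x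
      using feas by (force simp: K_def feasible_def indicator_def)
  qed
  also have "\<dots> = (LINT x:X|lebesgue. w x) + \<epsilon> * measure lebesgue X"
    using XL by (simp add: set_integral_add(2)[OF w e] set_lebesgue_integral_def[of _ _ "\<lambda>_. \<epsilon>"] fmeasurable_def)
  finally show ?thesis by (simp add: cost_def K_def)
qed

subsection \<open>Mollification\<close>

text \<open>Differentiation under the integral sign delivers the derivative as a bounded linear map
  depending continuously on the point; evaluation on the basis turns it into a continuous
  gradient.\<close>

lemma C1I_blinfun:
  fixes J :: "real^'n \<Rightarrow> real"
  assumes deriv: "\<And>x. (J has_derivative blinfun_apply (D x)) (at x)" and cont: "continuous_on UNIV D"
  shows "C1 J"
proof -
  have "gradient J x = (\<Sum>b\<in>Basis. blinfun_apply (D x) b *\<^sub>R b)" for x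
    by (rule gradient_eq[OF gderiv_has_derivative[OF deriv]])
  then have "gradient J = (\<lambda>x. \<Sum>b\<in>Basis. blinfun_apply (D x) b *\<^sub>R b)" by blast
  moreover have "continuous_on UNIV (\<lambda>x. \<Sum>b\<in>Basis. blinfun_apply (D x) b *\<^sub>R b)"
    by (intro continuous_intros cont)
  ultimately show ?thesis
    using deriv by (auto simp: C1_def differentiable_on_def differentiable_def)
qed

lemma DERIV_max_0_power2: "((\<lambda>u::real. (max 0 u)\<^sup>2) has_real_derivative 2 * max 0 u) (at u)"
proof (cases u "0::real" rule: linorder_cases)
  case less
  have "((\<lambda>u::real. 0) has_real_derivative 2 * max 0 u) (at u)"
    using less by (auto intro!: derivative_eq_intros)
  then show ?thesis
    by (rule has_field_derivative_transform_within[where d = "-u"]) (use less in \<open>auto simp: dist_real_def\<close>)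
next
  case equal
  \<comment> \<open>The slope function at 0 is \<open>max 0\<close> itself, because the square of
    \<open>max 0 z\<close> equals \<open>max 0 z * z\<close>.\<close>
  show ?thesis unfolding CARAT_DERIV
    by (rule exI[of _ "max 0"]) (use equal in \<open>auto intro!: continuous_intros simp: max_def power2_eq_square\<close>)
next
  case greater
  have "((\<lambda>u::real. u\<^sup>2) has_real_derivative 2 * max 0 u) (at u)"
    using greater by (auto intro!: derivative_eq_intros)
  then show ?thesis
    by (rule has_field_derivative_transform_within[where d = u]) (use greater in \<open>auto simp: dist_real_def\<close>)
qed

lemma lborel_integral_translate:
  fixes g :: "'a::euclidean_space \<Rightarrow> real"
  assumes "g \<in> borel_measurable borel"
  shows "(LINT y|lborel. g (x + y)) = (LINT t|lborel. g t)"
  using integral_distr[of "(+) x" lborel borel g] assms by (simp add: lborel_distr_plus)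

text \<open>An unnormalised radial kernel, supported in the ball of radius \<open>\<sigma>\<close>
  for positive \<open>\<sigma>\<close>. Squaring the positive part makes the polynomial profile C1
  across the sphere, which is the regularity asked of \<open>J\<close>.\<close>

definition bump :: "real \<Rightarrow> 'a::real_inner \<Rightarrow> real" where
  "bump \<sigma> z = (max 0 (\<sigma>\<^sup>2 - z \<bullet> z))\<^sup>2"

lemma bump_nonneg: "0 \<le> bump \<sigma> z" by (simp add: bump_def)

lemma bump_minus: "bump \<sigma> (- z) = bump \<sigma> z" by (simp add: bump_def)

lemma bump_eq_0: "0 < \<sigma> \<Longrightarrow> \<sigma> \<le> norm z \<Longrightarrow> bump \<sigma> z = 0"
  using power_mono[of \<sigma> "norm z" 2] by (simp add: bump_def power2_norm_eq_inner max_def)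

lemma continuous_on_bump [continuous_intros]:
  "continuous_on S g \<Longrightarrow> continuous_on S (\<lambda>x. bump \<sigma> (g x))"
  unfolding bump_def by (intro continuous_intros)

lemma has_derivative_bump:
  "(bump \<sigma> has_derivative (\<lambda>h. h \<bullet> ((- 4 * max 0 (\<sigma>\<^sup>2 - z \<bullet> z)) *\<^sub>R z))) (at z)"
proof -
  have "((\<lambda>z. \<sigma>\<^sup>2 - z \<bullet> z) has_derivative (\<lambda>h. - (2 * (h \<bullet> z)))) (at z)"
    by (auto intro!: derivative_eq_intros simp: inner_commute)
  from has_derivative_compose[OF this DERIV_max_0_power2[unfolded has_field_derivative_def]]
  show ?thesis
    unfolding bump_def by (rule has_derivative_eq_rhs) (simp add: fun_eq_iff algebra_simps)
qed

lemma integrable_continuous_mult_bump: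
  fixes g :: "'a::euclidean_space \<Rightarrow> real"
  assumes "continuous_on UNIV g" "0 < \<sigma>"
  shows "integrable lborel (\<lambda>y. g y * bump \<sigma> y)"
proof -
  have "integrable lborel (\<lambda>y. indicator (cball 0 \<sigma>) y *\<^sub>R (g y * bump \<sigma> y))"
    by (intro borel_integrable_compact continuous_intros continuous_on_subset[OF assms(1)]) auto
  moreover have "(\<lambda>y. indicator (cball 0 \<sigma>) y *\<^sub>R (g y * bump \<sigma> y)) = (\<lambda>y. g y * bump \<sigma> y)"
    by (auto simp: fun_eq_iff indicator_def intro!: bump_eq_0[OF assms(2)])
  ultimately show ?thesis by simp
qed

lemma integral_bump_pos:
  assumes "0 < \<sigma>" shows "0 < (LINT y|lborel. bump \<sigma> (y :: 'a::euclidean_space))"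
proof -
  define c where "c = (3 / 4 * \<sigma>\<^sup>2)\<^sup>2"
  have c: "0 < c" using assms by (simp add: c_def)
  have "0 < c * measure lborel (ball (0::'a) (\<sigma> / 2))"
    using c content_ball_pos[of "\<sigma> / 2"] assms by simp
  also have "\<dots> = (LINT y|lborel. c * indicator (ball (0::'a) (\<sigma> / 2)) y)"
    by simp
  also have "\<dots> \<le> (LINT y|lborel. bump \<sigma> (y :: 'a))"
  proof (rule integral_mono)
    show "integrable lborel (\<lambda>y::'a. c * indicator (ball 0 (\<sigma> / 2)) y)"
      by (auto intro!: integrable_mult_right integrable_real_indicator emeasure_lborel_ball_finite)
    show "integrable lborel (\<lambda>y::'a. bump \<sigma> y)"
      using integrable_continuous_mult_bump[of "\<lambda>_. 1", OF _ assms] by simp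
    fix y :: 'a
    show "c * indicator (ball 0 (\<sigma> / 2)) y \<le> bump \<sigma> y"
    proof (cases "y \<in> ball 0 (\<sigma> / 2)")
      case True
      then have "(norm y)\<^sup>2 \<le> (\<sigma> / 2)\<^sup>2" by (intro power_mono) auto
      then have "3 / 4 * \<sigma>\<^sup>2 \<le> \<sigma>\<^sup>2 - y \<bullet> y"
        by (simp add: power2_norm_eq_inner power_divide)
      then have "c \<le> bump \<sigma> y"
        unfolding c_def bump_def by (intro power_mono) (auto simp: le_max_iff_disj)
      then show ?thesis using True by simp
    qed (simp add: bump_nonneg)
  qed
  finally show ?thesis .
qed

text \<open>\<open>J x\<close> is a weighted mean of \<open>V\<close> over the ball of radius
  \<open>\<sigma>\<close> about \<open>x\<close>, so lower bounds pass to it. Its directional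
  derivative is a limit of one-sided difference quotients, which are means of those of
  \<open>V\<close>; a difference inequality uniform over the ball thus suffices for a merely
  continuous \<open>V\<close>. The vector \<open>v\<close> is common to the ball since a shift of
  \<open>x\<close> translates all of it, and the term \<open>- V z\<close> averages to
  \<open>- J x\<close>.\<close>

lemma C1_mollification:
  fixes V :: "real^'n \<Rightarrow> real"
  assumes V: "continuous_on UNIV V" and X: "bounded X" and \<sigma>: "0 < \<sigma>"
  obtains J where "C1 J"
    "\<And>x b. x \<in> X \<Longrightarrow> \<forall>z\<in>cball x \<sigma>. b \<le> V z \<Longrightarrow> b \<le> J x"
    "\<And>x v c. x \<in> X \<Longrightarrow>
       \<forall>e>0. \<exists>h0>0. \<forall>h\<in>{0<..<h0}. \<forall>z\<in>cball x \<sigma>. V (z + h *\<^sub>R v) - V z \<le> h * (c + e - V z) \<Longrightarrow>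
       gradient J x \<bullet> v + J x \<le> c"
proof -
  obtain R where R: "\<And>x. x \<in> X \<Longrightarrow> norm x \<le> R" using X by (auto simp: bounded_iff)
  \<comment> \<open>The box contains the support of the kernel about every point of norm at most
    \<open>R + 1\<close>; the extra 1 leaves room for the shifts
    \<open>x + h *\<^sub>R v\<close>.\<close>
  obtain a where a: "cball (0::real^'n) (R + 1 + \<sigma>) \<subseteq> cbox (- a) a"
    using bounded_subset_cbox_symmetric[OF bounded_cball] by blast
  define C where "C = (LINT y|lborel. bump \<sigma> (y :: real^'n))"
  have C: "0 < C" unfolding C_def by (rule integral_bump_pos[OF \<sigma>])
  define k where "k z = bump \<sigma> z / C" for z :: "real^'n"
  have k0: "0 \<le> k z" for z using C by (simp add: k_def bump_nonneg)
  have kout: "k z = 0" if "\<sigma> \<le> norm z" for z using bump_eq_0[OF \<sigma> that] by (simp add: k_def)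
  have contk: "continuous_on S (\<lambda>x. k (g x))" if "continuous_on S g" for S and g :: "real^'n \<Rightarrow> real^'n"
    unfolding k_def using C that by (intro continuous_intros) auto
  have intk: "integrable lborel (\<lambda>y. g y * k y)" if "continuous_on UNIV g" for g :: "real^'n \<Rightarrow> real"
    using integrable_divide[OF integrable_continuous_mult_bump[OF that \<sigma>], of C] by (simp add: k_def)
  have k1: "(LINT y|lborel. k y) = 1"
    using C by (simp add: k_def C_def)
  define J where "J x = integral (cbox (- a) a) (\<lambda>t. V t * k (x - t))" for x
  define fx where "fx x t = blinfun_inner_left
      ((V t / C * (- 4 * max 0 (\<sigma>\<^sup>2 - (x - t) \<bullet> (x - t)))) *\<^sub>R (x - t))" for x t :: "real^'n"
  have contV: "continuous_on S (\<lambda>x. V (g x))" if "continuous_on S g" for S and g :: "'b::topological_space \<Rightarrow> real^'n"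
    by (rule continuous_on_compose2[OF V that]) auto
  have contfx: "continuous_on (UNIV \<times> cbox (- a) a) (\<lambda>(x, t). fx x t)"
    unfolding fx_def case_prod_beta
    by (intro bounded_linear.continuous_on[OF bounded_linear_blinfun_inner_left] continuous_intros contV)
       (use C in auto)
  \<comment> \<open>The variable \<open>x\<close> occurs only in the kernel, so the derivative falls
    on the kernel and \<open>V\<close> contributes just its continuity; the fixed box supplies the
    compact domain.\<close>
  have "((\<lambda>x. J x) has_derivative blinfun_apply (integral (cbox (- a) a) (fx x))) (at x)" for x
    unfolding J_def
  proof (rule leibniz_rule[where U = UNIV])
    fix x t :: "real^'n"
    have "((\<lambda>x. V t / C * bump \<sigma> (x - t)) has_derivative
        (\<lambda>h. V t / C * (h \<bullet> ((- 4 * max 0 (\<sigma>\<^sup>2 - (x - t) \<bullet> (x - t))) *\<^sub>R (x - t))))) (at x)"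
      by (intro has_derivative_mult_right has_derivative_compose[OF _ has_derivative_bump, of "\<lambda>x. x - t" "\<lambda>h. h"])
         (auto intro!: derivative_eq_intros)
    then show "((\<lambda>x. V t * k (x - t)) has_derivative blinfun_apply (fx x t)) (at x)"
      by (rule has_derivative_eq_rhs[THEN has_derivative_transform_within[OF _ zero_less_one]])
         (auto simp: k_def fx_def fun_eq_iff)
  next
    show "(\<lambda>t. V t * k (x - t)) integrable_on cbox (- a) a" for x
      by (intro integrable_continuous continuous_intros contV contk)
  qed (use contfx in auto)
  moreover have "continuous_on UNIV (\<lambda>x. integral (cbox (- a) a) (fx x))"
    by (rule integral_continuous_on_param[OF contfx])
  ultimately have J: "C1 J" by (rule C1I_blinfun)
  \<comment> \<open>In this ball the box integral is a full convolution, and translation moves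
    \<open>x\<close> from the kernel to \<open>V\<close>, the function that the difference
    inequality is about.\<close>
  have rep: "J x = (LINT y|lborel. V (x + y) * k y)" if x: "norm x \<le> R + 1" for x
  proof -
    have "set_integrable lborel (cbox (- a) a) (\<lambda>t. V t * k (x - t))"
      unfolding set_integrable_def
      by (intro borel_integrable_compact compact_cbox continuous_intros contV contk)
    from set_borel_integral_eq_integral(2)[OF this]
    have "J x = (LINT t|lborel. indicator (cbox (- a) a) t *\<^sub>R (V t * k (x - t)))"
      by (simp add: J_def set_lebesgue_integral_def)
    also have "\<dots> = (LINT t|lborel. V t * k (x - t))"
    proof (rule Bochner_Integration.integral_cong[OF refl])
      fix t
      show "indicator (cbox (- a) a) t *\<^sub>R (V t * k (x - t)) = V t * k (x - t)"
      proof (cases "t \<in> cbox (- a) a")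
        case False
        then have "t \<notin> cball 0 (R + 1 + \<sigma>)" using a by blast
        then have "R + 1 + \<sigma> < norm t" by simp
        then have "\<sigma> \<le> norm (x - t)" using x norm_triangle_ineq2[of t x] by (simp add: norm_minus_commute)
        then show ?thesis using kout by simp
      qed simp
    qed
    also have "\<dots> = (LINT y|lborel. V (x + y) * k (x - (x + y)))"
      by (intro lborel_integral_translate[symmetric] borel_measurable_continuous_onI
          continuous_intros contV contk)
    also have "\<dots> = (LINT y|lborel. V (x + y) * k y)"
      by (simp add: k_def bump_minus)
    finally show ?thesis .
  qed
  have int: "integrable lborel (\<lambda>y. V (x + y) * k y)" for x
    by (intro intk contV continuous_intros)
  show ?thesis
  proof (rule that[of J])
    fix x b assume x: "x \<in> X" and b: "\<forall>z\<in>cball x \<sigma>. b \<le> V z"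
    have "b = (LINT y|lborel. b * k y)" using k1 by simp
    also have "\<dots> \<le> (LINT y|lborel. V (x + y) * k y)"
    proof (rule integral_mono[OF intk[OF continuous_on_const] int])
      show "b * k y \<le> V (x + y) * k y" for y
        using bspec[OF b, of "x + y"] kout[of y] k0[of y]
        by (cases "norm y \<le> \<sigma>") (auto simp: dist_norm intro: mult_right_mono)
    qed
    finally show "b \<le> J x" using rep[of x] R[OF x] by simp
  next
    fix x v c
    assume x: "x \<in> X" and dec: "\<forall>e>0. \<exists>h0>0. \<forall>h\<in>{0<..<h0}. \<forall>z\<in>cball x \<sigma>.
      V (z + h *\<^sub>R v) - V z \<le> h * (c + e - V z)"
    have "gradient J x \<bullet> v \<le> (c - J x) + e" if e: "0 < e" for e
    proof -
      obtain h0 where h0: "0 < h0"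
        and h: "\<And>h z. 0 < h \<Longrightarrow> h < h0 \<Longrightarrow> z \<in> cball x \<sigma> \<Longrightarrow> V (z + h *\<^sub>R v) - V z \<le> h * (c + e - V z)"
        using dec e by (metis greaterThanLessThan_iff)
      \<comment> \<open>The second term keeps \<open>x + h *\<^sub>R v\<close> in the ball of radius
        \<open>R + 1\<close>, where \<open>rep\<close> holds.\<close>
      define h1 where "h1 = min h0 (1 / (norm v + 1))"
      have h1: "0 < h1" using h0 by (simp add: h1_def add_nonneg_pos)
      have quot: "(J (x + h *\<^sub>R v) - J x) / h \<le> c + e - J x" if hh: "0 < h" "h < h1" for h
      proof -
        have "0 < norm v + 1" by (simp add: add_nonneg_pos)
        then have "h * (norm v + 1) < 1"
          using hh by (simp add: h1_def pos_less_divide_eq)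
        then have "norm (h *\<^sub>R v) \<le> 1" using hh by (simp add: algebra_simps)
        then have n: "norm (x + h *\<^sub>R v) \<le> R + 1" "norm x \<le> R + 1"
          using R[OF x] norm_triangle_ineq[of x "h *\<^sub>R v"] by auto
        have "J (x + h *\<^sub>R v) - J x
            = (LINT y|lborel. V (x + h *\<^sub>R v + y) * k y - V (x + y) * k y)"
          by (simp add: rep[OF n(1)] rep[OF n(2)] int)
        also have "\<dots> \<le> (LINT y|lborel. (h * (c + e)) * k y - h * (V (x + y) * k y))"
        proof (rule integral_mono)
          show "integrable lborel (\<lambda>y. V (x + h *\<^sub>R v + y) * k y - V (x + y) * k y)"
            by (intro Bochner_Integration.integrable_diff int)
          show "integrable lborel (\<lambda>y. (h * (c + e)) * k y - h * (V (x + y) * k y))"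
            by (intro Bochner_Integration.integrable_diff integrable_mult_right int intk continuous_on_const)
          fix y
          show "V (x + h *\<^sub>R v + y) * k y - V (x + y) * k y \<le> (h * (c + e)) * k y - h * (V (x + y) * k y)"
          proof (cases "norm y \<le> \<sigma>")
            case True
            then have "V (x + y + h *\<^sub>R v) - V (x + y) \<le> h * (c + e - V (x + y))"
              using hh by (intro h) (auto simp: h1_def dist_norm)
            from mult_right_mono[OF this k0[of y]] show ?thesis
              by (simp add: algebra_simps)
          qed (simp add: kout)
        qed
        also have "\<dots> = h * (c + e) * (LINT y|lborel. k y) - h * J x"
          using intk[of "\<lambda>_. h * (c + e)"] by (simp add: rep[OF n(2)] int)
        finally have "J (x + h *\<^sub>R v) - J x \<le> (c + e - J x) * h"
          using k1 by (simp add: algebra_simps)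
        then show ?thesis
          using hh by (simp add: pos_divide_le_eq)
      qed
      have "((\<lambda>h. J (x + h *\<^sub>R v)) has_derivative (\<lambda>h. (h *\<^sub>R v) \<bullet> gradient J x)) (at 0)"
        by (rule has_derivative_compose[of "\<lambda>h. x + h *\<^sub>R v" "\<lambda>h. h *\<^sub>R v"])
           (use C1_gderiv[OF J, of x] in \<open>auto intro!: derivative_eq_intros simp: gderiv_def\<close>)
      then have "((\<lambda>h. J (x + h *\<^sub>R v)) has_real_derivative gradient J x \<bullet> v) (at 0)"
        unfolding has_field_derivative_def
        by (rule has_derivative_eq_rhs) (simp add: fun_eq_iff inner_commute mult.commute)
      then have "((\<lambda>h. (J (x + h *\<^sub>R v) - J x) / h) \<longlongrightarrow> gradient J x \<bullet> v) (at_right 0)"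
        unfolding has_field_derivative_iff by (auto intro: tendsto_within_subset)
      moreover have "\<forall>\<^sub>F h in at_right 0. (J (x + h *\<^sub>R v) - J x) / h \<le> c + e - J x"
        using quot h1 unfolding eventually_at_right_field by blast
      ultimately have "gradient J x \<bullet> v \<le> c + e - J x"
        by (rule tendsto_upperbound) simp
      then show ?thesis by simp
    qed
    then have "gradient J x \<bullet> v \<le> c - J x" by (rule field_le_epsilon)
    then show "gradient J x \<bullet> v + J x \<le> c" by simp
  qed (rule J)
qed

subsection \<open>Almost optimal feasible triples\<close>

text \<open>A non-smooth Lyapunov function: the largest exponentially weighted excess distance from \<open>A\<close>
  along the orbit. The excess vanishes after time \<open>T\<close>, so the supremum over \<open>{0..T}\<close> is one over
  all \<open>t \<ge> 0\<close>, and restarting the orbit at time \<open>h\<close> costs exactly the factor \<open>exp (- h)\<close>.\<close>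

lemma lipschitz_lyapunov_function:
  assumes f: "locally_lipschitz f" and A: "A \<noteq> {}" "compact A" and st: "asymptotically_stable f A"
    and N: "compact N" "N \<subseteq> basin f A" and L: "L-lipschitz_on (cball 0 R) f"
    and R: "\<And>x t. x \<in> N \<Longrightarrow> 0 \<le> t \<Longrightarrow> flow f t x \<in> cball 0 R"
    and r: "0 < r" and c: "0 \<le> c"
  obtains V M where "M-lipschitz_on N V"
    "\<And>x. x \<in> N \<Longrightarrow> 0 \<le> V x" "\<And>x. x \<in> N \<Longrightarrow> c * (infdist x A - r) \<le> V x"
    "\<And>x h. x \<in> N \<Longrightarrow> 0 \<le> h \<Longrightarrow> flow f h x \<in> N \<Longrightarrow> V (flow f h x) \<le> exp (- h) * V x"
proof -
  obtain T where T: "0 \<le> T" "\<And>y t. y \<in> N \<Longrightarrow> T \<le> t \<Longrightarrow> infdist (flow f t y) A < r"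
    by (rule basin_compact_uniform[OF f A st N r]) blast
  obtain a where a: "a \<in> A" using A by blast
  have L0: "0 \<le> L" using L by (rule lipschitz_on_nonneg)
  \<comment> \<open>The slope \<open>c\<close> allows the function to be lifted above a given
    threshold at a given distance; the cutoff at \<open>r\<close> makes the excess vanish where all
    orbits are from time \<open>T\<close> on.\<close>
  define g where "g p = c * max 0 (infdist p A - r)" for p
  have g0: "0 \<le> g p" for p using c by (simp add: g_def)
  have gB: "g p \<le> c * (R + norm a)" if "p \<in> cball 0 R" for p
  proof -
    have "infdist p A \<le> dist p a" by (rule infdist_le[OF a])
    also have "\<dots> \<le> R + norm a"
      using that norm_triangle_ineq4[of p a] by (simp add: dist_norm)
    finally have "infdist p A \<le> R + norm a" .
    moreover have "0 \<le> R" using that norm_ge_zero[of p] by (simp del: norm_ge_zero)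
    ultimately show ?thesis
      unfolding g_def using r c by (intro mult_left_mono) (auto simp: add_nonneg_nonneg)
  qed
  have gL: "g p \<le> g q + c * dist p q" for p q
  proof -
    have "max 0 (infdist p A - r) \<le> max 0 (infdist q A - r) + dist p q"
      using infdist_triangle[of p A q] by simp
    then have "c * max 0 (infdist p A - r) \<le> c * (max 0 (infdist q A - r) + dist p q)"
      using c by (rule mult_left_mono)
    then show ?thesis by (simp add: g_def algebra_simps)
  qed
  define V where "V x = (SUP t\<in>{0..T}. exp t * g (flow f t x))" for x
  have bdd: "bdd_above ((\<lambda>t. exp t * g (flow f t x)) ` {0..T})" if "x \<in> N" for x
  proof (rule bdd_aboveI2)
    fix t assume t: "t \<in> {0..T}"
    show "exp t * g (flow f t x) \<le> exp T * (c * (R + norm a))"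
      using t gB[OF R[OF that]] g0 by (intro mult_mono) auto
  qed
  have upper: "exp t * g (flow f t x) \<le> V x" if "x \<in> N" "t \<in> {0..T}" for x t
    unfolding V_def by (rule cSUP_upper[OF that(2) bdd[OF that(1)]])
  have ne: "{0..T} \<noteq> {}" using T by simp
  have gN: "global_forward f x" if "x \<in> N" for x using that N(2) by (auto simp: basin_def)
  have Vg: "g x \<le> V x" if "x \<in> N" for x
    using upper[OF that, of 0] T(1) flow_0[OF f gN[OF that]] by simp
  have Vpos: "0 \<le> V x" if "x \<in> N" for x
    using Vg[OF that] g0[of x] by simp
  define M where "M = exp T * (c * exp (L * T))"
  have lip: "V x \<le> V y + M * dist x y" if x: "x \<in> N" and y: "y \<in> N" for x y
    unfolding V_def[of x]
  proof (rule cSUP_least[OF ne])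
    fix t assume t: "t \<in> {0..T}"
    have "dist (flow f t x) (flow f t y) \<le> exp (L * t) * dist x y"
      by (rule flow_lipschitz[OF f L]) (use x y t R gN in auto)
    also have "\<dots> \<le> exp (L * T) * dist x y"
      using t L0 by (intro mult_right_mono) (auto intro: mult_left_mono)
    finally have d: "dist (flow f t x) (flow f t y) \<le> exp (L * T) * dist x y" .
    have "exp t * g (flow f t x) \<le> exp t * (g (flow f t y) + c * dist (flow f t x) (flow f t y))"
      by (intro mult_left_mono gL) simp
    also have "\<dots> \<le> V y + exp t * (c * dist (flow f t x) (flow f t y))"
      using upper[OF y t] by (simp add: algebra_simps)
    also have "exp t * (c * dist (flow f t x) (flow f t y)) \<le> exp T * (c * (exp (L * T) * dist x y))"
      using t d c by (intro mult_mono) auto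
    finally show "exp t * g (flow f t x) \<le> V y + M * dist x y"
      by (simp add: M_def mult.assoc)
  qed
  show ?thesis
  proof (rule that[of M V])
    show "M-lipschitz_on N V"
    proof (rule lipschitz_onI)
      show "dist (V x) (V y) \<le> M * dist x y" if "x \<in> N" "y \<in> N" for x y
        using lip[OF that] lip[OF that(2,1)] by (simp add: dist_real_def dist_commute abs_le_iff)
      show "0 \<le> M" using c by (simp add: M_def)
    qed
    fix x assume x: "x \<in> N"
    show "0 \<le> V x" by (rule Vpos[OF x])
    have "c * (infdist x A - r) \<le> g x" unfolding g_def using c by (intro mult_left_mono) auto
    then show "c * (infdist x A - r) \<le> V x" using Vg[OF x] by simp
    fix h :: real assume h: "0 \<le> h" and "flow f h x \<in> N"
    show "V (flow f h x) \<le> exp (- h) * V x"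
      unfolding V_def[of "flow f h x"]
    proof (rule cSUP_least[OF ne])
      fix t assume t: "t \<in> {0..T}"
      have eq: "flow f t (flow f h x) = flow f (h + t) x"
        using flow_add[OF f gN[OF x] h] t by simp
      have "exp (h + t) * g (flow f (h + t) x) \<le> V x"
      proof (cases "h + t \<le> T")
        case True
        then show ?thesis using upper[OF x] h t by simp
      next
        case False
        then have "g (flow f (h + t) x) = 0"
          using T(2)[OF x, of "h + t"] by (simp add: g_def)
        then show ?thesis using Vpos[OF x] by simp
      qed
      then have "exp (- h) * (exp (h + t) * g (flow f (h + t) x)) \<le> exp (- h) * V x"
        by (intro mult_left_mono) auto
      moreover have "exp (- h) * (exp (h + t) * g (flow f (h + t) x)) = exp t * g (flow f t (flow f h x))"
        by (simp add: eq mult.assoc[symmetric] exp_add[symmetric])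
      ultimately show "exp t * g (flow f t (flow f h x)) \<le> exp (- h) * V x" by simp
    qed
  qed
qed

lemma exp_minus_le_quadratic: "0 \<le> h \<Longrightarrow> exp (- h) \<le> 1 - h + h\<^sup>2" for h :: real
proof -
  assume h: "0 \<le> h"
  have "exp (- h) * (1 + h) \<le> exp (- h) * exp h"
    by (intro mult_left_mono exp_ge_add_one_self) simp
  also have "\<dots> = 1" by (simp add: exp_minus)
  \<comment> \<open>The product on the right is \<open>1 + h ^ 3\<close>.\<close>
  also have "\<dots> \<le> (1 - h + h\<^sup>2) * (1 + h)"
    using h by (simp add: algebra_simps power2_eq_square)
  finally show ?thesis using h by (simp add: mult_le_cancel_right)
qed

text \<open>The mean value inequality for the deviation from the tangent is applied twice: with the
  crude bound \<open>2 * F\<close> on the change of \<open>f\<close>, which yields the displacement,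
  then with the Lipschitz bound along that displacement. The 3 is \<open>2 + 1\<close> and not
  sharp; only the orders in \<open>h\<close> matter.\<close>

lemma flow_euler_error:
  assumes f: "locally_lipschitz f" and L: "L-lipschitz_on S f" and z: "global_forward f z"
    and S: "\<And>t. 0 \<le> t \<Longrightarrow> flow f t z \<in> S" and F: "\<And>p. p \<in> S \<Longrightarrow> norm (f p) \<le> F" and h: "0 \<le> h"
  shows "norm (flow f h z - z) \<le> 3 * F * h" (is ?A)
    and "norm (flow f h z - z - h *\<^sub>R f z) \<le> 3 * L * F * h\<^sup>2" (is ?B)
proof -
  have z0: "flow f 0 z = z" by (rule flow_0[OF f z])
  have L0: "0 \<le> L" using L by (rule lipschitz_on_nonneg)
  have zS: "z \<in> S" using S[of 0] z0 by simp
  have F0: "0 \<le> F" using F[OF zS] norm_ge_zero[of "f z"] by linarith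
  have lin: "norm (flow f t z - z - t *\<^sub>R f z) \<le> t * B"
    if t: "0 \<le> t" and B: "\<And>s. s \<in> {0..t} \<Longrightarrow> norm (f (flow f s z) - f z) \<le> B" for t B
    using vector_differentiable_bound_linearization[where f = "\<lambda>t. flow f t z"
        and f' = "\<lambda>t. f (flow f t z)" and S = "{0..t}" and a = 0 and b = t and ?x0.0 = 0 and B = B]
      ode_solution_flow[OF f z t] t B
    by (simp add: z0 ode_solution_def closed_segment_eq_real_ivl)
  have step: "norm (flow f t z - z) \<le> 3 * F * t" if t: "0 \<le> t" for t
  proof -
    have "norm (flow f t z - z - t *\<^sub>R f z) \<le> t * (2 * F)"
    proof (rule lin[OF t])
      fix s assume "s \<in> {0..t}"
      then show "norm (f (flow f s z) - f z) \<le> 2 * F"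
        using norm_triangle_ineq4[of "f (flow f s z)" "f z"] F[OF S, of s] F[OF zS] by simp
    qed
    moreover have "norm (t *\<^sub>R f z) \<le> t * F" using t F[OF zS] by (simp add: mult_left_mono)
    ultimately show ?thesis
      using norm_triangle_sub[of "flow f t z - z" "t *\<^sub>R f z"] by (simp add: algebra_simps)
  qed
  show ?A by (rule step[OF h])
  have "norm (flow f h z - z - h *\<^sub>R f z) \<le> h * (L * (3 * F * h))"
  proof (rule lin[OF h])
    fix s assume s: "s \<in> {0..h}"
    have "norm (f (flow f s z) - f z) \<le> L * norm (flow f s z - z)"
      using lipschitz_onD[OF L S[of s] zS] s by (simp add: dist_norm)
    also have "\<dots> \<le> L * (3 * F * h)"
      using step[of s] s F0 L0 by (intro mult_left_mono order_trans[OF step]) (auto intro: mult_left_mono)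
    finally show "norm (f (flow f s z) - f z) \<le> L * (3 * F * h)" .
  qed
  then show ?B by (simp add: power2_eq_square algebra_simps)
qed

text \<open>Averaging over balls of radius \<open>\<sigma>\<close> moves the foot point of \<open>f\<close> by at most \<open>\<sigma>\<close>, which
  spoils the decay rate of the Lyapunov function only by \<open>M * L * \<sigma>\<close>; the slack \<open>\<epsilon>\<close> absorbs this.\<close>

lemma C1_approximate_lyapunov:
  assumes f: "locally_lipschitz f" and X: "compact X" and sca: "stable_compact_attractor f X A"
    and \<eta>: "0 < \<eta>" and \<epsilon>: "0 < \<epsilon>"
  obtains J where "C1 J" "\<And>x. x \<in> X \<Longrightarrow> 0 \<le> J x" "\<And>x. x \<in> X \<Longrightarrow> \<eta> \<le> infdist x A \<Longrightarrow> 1 \<le> J x"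
    "\<And>x. x \<in> X \<Longrightarrow> gradient J x \<bullet> f x + J x \<le> \<epsilon>"
proof -
  from sca have A: "A \<noteq> {}" "compact A" "A \<subseteq> X" and st: "asymptotically_stable f A"
    by (auto simp: stable_compact_attractor_def)
  have X0: "X \<noteq> {}" using A by auto
  obtain s L R where s: "0 < s" and L: "L-lipschitz_on (cball 0 R) f"
    and basin: "\<And>x. infdist x X \<le> s \<Longrightarrow> x \<in> basin f A"
    and R: "\<And>x t. infdist x X \<le> s \<Longrightarrow> 0 \<le> t \<Longrightarrow> flow f t x \<in> cball 0 R"
    by (rule stable_compact_attractor_neighbourhood[OF f X sca]) (rule that)
  have L0: "0 \<le> L" using L by (rule lipschitz_on_nonneg)
  define N where "N = {x. infdist x X \<le> s}"
  have N: "compact N" "N \<subseteq> basin f A" "\<And>x t. x \<in> N \<Longrightarrow> 0 \<le> t \<Longrightarrow> flow f t x \<in> cball 0 R"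
    using compact_infdist_le[OF X0 X s] basin R by (auto simp: N_def)
  \<comment> \<open>At distance \<open>\<eta>\<close> from \<open>A\<close> these parameters make
    \<open>V\<close> at least 2; one unit is reserved for the oscillation of \<open>V\<close> over
    the averaging ball.\<close>
  obtain V M where M: "M-lipschitz_on N V"
    and V0: "\<And>x. x \<in> N \<Longrightarrow> 0 \<le> V x" and V: "\<And>x. x \<in> N \<Longrightarrow> 4 / \<eta> * (infdist x A - \<eta> / 2) \<le> V x"
    and decay: "\<And>x h. x \<in> N \<Longrightarrow> 0 \<le> h \<Longrightarrow> flow f h x \<in> N \<Longrightarrow> V (flow f h x) \<le> exp (- h) * V x"
    by (rule lipschitz_lyapunov_function[OF f A(1,2) st N(1,2) L N(3), of "\<eta> / 2" "4 / \<eta>"])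
       (use \<eta> in \<open>auto intro: that\<close>)
  have M0: "0 \<le> M" using M by (rule lipschitz_on_nonneg)
  have contV: "continuous_on N V" by (rule lipschitz_on_continuous_on[OF M])
  \<comment> \<open>Mollification takes a function continuous on the whole space. The estimates
    below evaluate the extension only at points of \<open>N\<close>.\<close>
  obtain W where W: "continuous_on UNIV W" "\<And>x. x \<in> N \<Longrightarrow> W x = V x"
    by (rule Tietze_unbounded[OF contV, of UNIV]) (use N(1) compact_imp_closed in auto)
  have "bounded (V ` N)" by (intro compact_imp_bounded compact_continuous_image contV N(1))
  then obtain b where b: "0 < b" "\<And>x. x \<in> N \<Longrightarrow> V x \<le> b"
    by (force simp: bounded_pos)
  have "bounded (f ` cball 0 R)"
    by (intro compact_imp_bounded compact_continuous_image locally_lipschitz_continuous_on f compact_cball)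
  then obtain F where F: "0 < F" "\<And>p. p \<in> cball 0 R \<Longrightarrow> norm (f p) \<le> F"
    by (auto simp: bounded_pos)
  \<comment> \<open>\<open>s / 2\<close> keeps the averaging ball in \<open>N\<close> and leaves
    \<open>s / 2\<close> for a time step; the other terms bound the oscillation by 1 and the loss of
    decay by \<open>\<epsilon>\<close>. Adding 1 avoids division by 0.\<close>
  define \<sigma> where "\<sigma> = min (s / 2) (min (1 / (M + 1)) (\<epsilon> / (M * L + 1)))"
  have \<sigma>: "0 < \<sigma>"
    using s \<epsilon> M0 L0 by (simp add: \<sigma>_def add_nonneg_pos)
  have \<sigma>s: "\<sigma> \<le> s / 2"
    unfolding \<sigma>_def by (rule min.cobounded1)
  have "M * \<sigma> \<le> M * (1 / (M + 1))"
    using M0 by (intro mult_left_mono) (auto simp: \<sigma>_def)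
  also have "\<dots> \<le> 1" using M0 by simp
  finally have osc: "M * \<sigma> \<le> 1" .
  have "M * L * \<sigma> \<le> M * L * (\<epsilon> / (M * L + 1))"
    using M0 L0 by (intro mult_left_mono) (auto simp: \<sigma>_def)
  also have "\<dots> = M * L / (M * L + 1) * \<epsilon>" by simp
  also have "\<dots> \<le> 1 * \<epsilon>"
    using M0 L0 \<epsilon> by (intro mult_right_mono) (auto simp: add_nonneg_pos)
  finally have slack: "M * L * \<sigma> \<le> \<epsilon>" by simp
  have near: "z \<in> N" if "x \<in> X" "dist x z \<le> s" for x z
    using infdist_le[OF that(1), of z] that(2) by (simp add: N_def dist_commute)
  have XN: "x \<in> N" if "x \<in> X" for x using near[OF that, of x] s by simp
  have gN: "global_forward f x" if "x \<in> N" for x using that N(2) by (auto simp: basin_def)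
  have NR: "x \<in> cball 0 R" if "x \<in> N" for x
    using N(3)[OF that, of 0] flow_0[OF f gN[OF that]] by simp
  obtain J where J: "C1 J" and J_lower: "\<And>x b. x \<in> X \<Longrightarrow> \<forall>z\<in>cball x \<sigma>. b \<le> W z \<Longrightarrow> b \<le> J x"
    and J_decay: "\<And>x v c. x \<in> X \<Longrightarrow> \<forall>e>0. \<exists>h0>0. \<forall>h\<in>{0<..<h0}. \<forall>z\<in>cball x \<sigma>.
       W (z + h *\<^sub>R v) - W z \<le> h * (c + e - W z) \<Longrightarrow> gradient J x \<bullet> v + J x \<le> c"
    by (rule C1_mollification[OF W(1) compact_imp_bounded[OF X] \<sigma>]) (rule that)
  show ?thesis
  proof (rule that[of J])
    fix x assume x: "x \<in> X"
    have zN: "z \<in> N" if "dist x z \<le> \<sigma>" for z using near[OF x, of z] that \<sigma>s s by simp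
    show "0 \<le> J x"
      by (rule J_lower[OF x]) (use zN W(2) V0 in auto)
    show "1 \<le> J x" if far: "\<eta> \<le> infdist x A"
    proof (rule J_lower[OF x], intro ballI)
      fix z assume "z \<in> cball x \<sigma>"
      then have z: "dist x z \<le> \<sigma>" by simp
      have "2 = 4 / \<eta> * (\<eta> - \<eta> / 2)" using \<eta> by simp
      also have "\<dots> \<le> 4 / \<eta> * (infdist x A - \<eta> / 2)"
        using far \<eta> by (intro mult_left_mono) auto
      also have "\<dots> \<le> V x" by (rule V[OF XN[OF x]])
      finally have "2 \<le> V x" .
      moreover have "V x - V z \<le> M * dist x z"
        using lipschitz_onD[OF M XN[OF x] zN[OF z]] by (simp add: dist_real_def)
      moreover have "M * dist x z \<le> M * \<sigma>" using z M0 by (intro mult_left_mono)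
      ultimately have "1 \<le> V z" using osc by linarith
      then show "1 \<le> W z" using W(2)[OF zN[OF z]] by simp
    qed
    have "gradient J x \<bullet> f x + J x \<le> M * L * \<sigma>"
    proof (rule J_decay[OF x], intro allI impI)
      fix e :: real assume e: "0 < e"
      \<comment> \<open>The coefficient of \<open>h\<^sup>2\<close> in the error: \<open>M\<close>
        times the Euler remainder, plus the quadratic term of \<open>exp (- h)\<close> times the
        bound \<open>b\<close> on \<open>V\<close>. Below \<open>h0\<close>, time steps move points
        by at most \<open>s / 2\<close> and this error is at most \<open>h * e\<close>.\<close>
      define D where "D = 3 * M * L * F + b"
      have D: "0 < D" using M0 L0 F b by (simp add: D_def add_nonneg_pos)
      define h0 where "h0 = min (s / (6 * F)) (e / D)"
      have h0: "0 < h0" using s F e D by (simp add: h0_def)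
      have "W (z + h *\<^sub>R f x) - W z \<le> h * (M * L * \<sigma> + e - W z)"
        if h: "0 < h" "h < h0" and z: "dist x z \<le> \<sigma>" for h z
      proof -
        have hF: "3 * F * h \<le> s / 2"
          using h F by (simp add: h0_def field_simps)
        have hD: "h * D \<le> e" using h D by (simp add: h0_def field_simps)
        note zN' = zN[OF z]
        define y where "y = flow f h z"
        have y1: "norm (y - z) \<le> 3 * F * h" and y2: "norm (y - z - h *\<^sub>R f z) \<le> 3 * L * F * h\<^sup>2"
          unfolding y_def using flow_euler_error[OF f L gN[OF zN'] _ F(2)] N(3)[OF zN'] h by auto
        have yN: "y \<in> N"
          by (rule near[OF x]) (use y1 hF z \<sigma>s dist_triangle[of x y z] in \<open>simp add: dist_norm norm_minus_commute\<close>)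
        have "norm (h *\<^sub>R f x) \<le> h * F"
          using h F(2)[OF NR[OF XN[OF x]]] by simp
        also have "\<dots> \<le> 3 * F * h" using h F by simp
        finally have "norm (h *\<^sub>R f x) \<le> s / 2" using hF by simp
        then have uN: "z + h *\<^sub>R f x \<in> N"
          by (intro near[OF x]) (use z \<sigma>s dist_triangle[of x "z + h *\<^sub>R f x" z] in \<open>simp add: dist_norm\<close>)
        have "norm (f x - f z) \<le> L * dist x z"
          using lipschitz_onD[OF L NR[OF XN[OF x]] NR[OF zN']] by (simp add: dist_norm)
        also have "\<dots> \<le> L * \<sigma>" using z L0 by (rule mult_left_mono)
        finally have fxz: "norm (h *\<^sub>R (f x - f z)) \<le> h * (L * \<sigma>)" using h by simp
        have "dist (z + h *\<^sub>R f x) y = norm (h *\<^sub>R (f x - f z) - (y - z - h *\<^sub>R f z))"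
          by (simp add: dist_norm algebra_simps)
        also have "\<dots> \<le> h * (L * \<sigma>) + 3 * L * F * h\<^sup>2"
          using fxz y2 norm_triangle_ineq4 by (meson add_mono order_trans)
        finally have d: "dist (z + h *\<^sub>R f x) y \<le> h * (L * \<sigma>) + 3 * L * F * h\<^sup>2" .
        have "V (z + h *\<^sub>R f x) \<le> V y + M * dist (z + h *\<^sub>R f x) y"
          using lipschitz_onD[OF M uN yN] by (simp add: dist_real_def)
        also have "\<dots> \<le> V y + M * (h * (L * \<sigma>) + 3 * L * F * h\<^sup>2)"
          using d M0 by (intro add_left_mono mult_left_mono)
        also have "V y \<le> exp (- h) * V z"
          unfolding y_def by (rule decay) (use zN' h yN in \<open>auto simp: y_def\<close>)
        also have "\<dots> \<le> (1 - h + h\<^sup>2) * V z"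
          using h V0[OF zN'] by (intro mult_right_mono exp_minus_le_quadratic) auto
        also have "\<dots> \<le> (1 - h) * V z + h\<^sup>2 * b"
          using b(2)[OF zN'] by (simp add: distrib_right mult_left_mono)
        finally have "V (z + h *\<^sub>R f x) - V z \<le> h * (M * L * \<sigma> - V z) + h * (h * D)"
          by (simp add: D_def algebra_simps power2_eq_square)
        also have "\<dots> \<le> h * (M * L * \<sigma> - V z) + h * e"
          using hD h by (intro add_left_mono mult_left_mono) auto
        finally show ?thesis
          using W(2)[OF uN] W(2)[OF zN'] by (simp add: algebra_simps)
      qed
      then show "\<exists>h0>0. \<forall>h\<in>{0<..<h0}. \<forall>z\<in>cball x \<sigma>.
          W (z + h *\<^sub>R f x) - W z \<le> h * (M * L * \<sigma> + e - W z)"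
        using h0 by (intro exI[of _ h0]) auto
    qed
    then show "gradient J x \<bullet> f x + J x \<le> \<epsilon>" using slack by simp
  qed (rule J)
qed

section \<open>The optimal value from above, and the theorem\<close>

lemma p_MA_le_neighbourhood:
  assumes f: "locally_lipschitz f" and X: "compact X" and sca: "stable_compact_attractor f X A"
    and \<eta>: "0 < \<eta>"
  shows "p_MA f X \<le> measure lebesgue (X \<inter> {x. infdist x A \<le> \<eta>}) + \<eta> * measure lebesgue X"
proof -
  obtain J where J: "C1 J" "\<And>x. x \<in> X \<Longrightarrow> 0 \<le> J x" "\<And>x. x \<in> X \<Longrightarrow> \<eta> \<le> infdist x A \<Longrightarrow> 1 \<le> J x"
    "\<And>x. x \<in> X \<Longrightarrow> gradient J x \<bullet> f x + J x \<le> \<eta>"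
    by (rule C1_approximate_lyapunov[OF f X sca \<eta> \<eta>]) (rule that)
  \<comment> \<open>The least admissible \<open>w\<close> for this \<open>J\<close>: at most 1 on
    \<open>X\<close>, and 0 at distance at least \<open>\<eta>\<close> from \<open>A\<close>. One
    parameter serves as radius and as slack, so both errors vanish together.\<close>
  define w where "w x = max 0 (1 - J x)" for x
  have w: "continuous_on X w" unfolding w_def by (intro continuous_intros C1_continuous_on J)
  have "(w, J, \<eta>) \<in> feasible f X"
    using w J \<eta> by (auto simp: feasible_def w_def)
  then have "p_MA f X \<le> cost X (w, J, \<eta>)"
    unfolding p_MA_def by (rule cINF_lower[OF cost_bdd_below])
  also have "\<dots> = (LINT x:X|lebesgue. w x) + \<eta> * measure lebesgue X"
    by (simp add: cost_def)
  also have "(LINT x:X|lebesgue. w x) \<le> (LINT x|lebesgue. indicator (X \<inter> {x. infdist x A \<le> \<eta>}) x)"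
    unfolding set_lebesgue_integral_def
  proof (rule integral_mono)
    show "integrable lebesgue (\<lambda>x. indicator X x *\<^sub>R w x)"
      using continuous_on_compact_set_integrable[OF X w] by (simp add: set_integrable_def)
    have "closed {x. infdist x A \<le> \<eta>}"
      by (intro closed_Collect_le continuous_intros)
    then have "X \<inter> {x. infdist x A \<le> \<eta>} \<in> lmeasurable"
      using X by (intro lmeasurable_compact compact_Int_closed)
    then show "integrable lebesgue (\<lambda>x. indicator (X \<inter> {x. infdist x A \<le> \<eta>}) x :: real)"
      by (auto simp: fmeasurable_def intro: integrable_real_indicator)
    show "indicator X x *\<^sub>R w x \<le> indicator (X \<inter> {x. infdist x A \<le> \<eta>}) x" for x
      using J(2,3)[of x] by (auto simp: indicator_def w_def)
  qed
  finally show ?thesis by simp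
qed

text \<open>The closed neighbourhoods shrink to \<open>A\<close> because it is closed, and
  continuity from above applies because their parts in \<open>X\<close> have finite measure.\<close>

lemma p_MA_le_measure:
  assumes f: "locally_lipschitz f" and X: "compact X" and sca: "stable_compact_attractor f X A"
  shows "p_MA f X \<le> measure lebesgue A"
proof -
  from sca have A: "A \<noteq> {}" "compact A" "A \<subseteq> X" by (auto simp: stable_compact_attractor_def)
  define \<eta> where "\<eta> n = 1 / real (Suc n)" for n
  have \<eta>: "0 < \<eta> n" for n by (simp add: \<eta>_def)
  have \<eta>_lim: "\<eta> \<longlonglongrightarrow> 0" unfolding \<eta>_def by (rule LIMSEQ_Suc[OF lim_1_over_n])
  define U where "U n = X \<inter> {x. infdist x A \<le> \<eta> n}" for n
  have U: "U n \<in> lmeasurable" for n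
    unfolding U_def using X
    by (intro lmeasurable_compact compact_Int_closed closed_Collect_le continuous_intros)
  have "(\<Inter>n. U n) = A"
  proof (intro equalityI subsetI)
    fix x assume x: "x \<in> (\<Inter>n. U n)"
    then have "infdist x A \<le> 0"
      by (intro LIMSEQ_le_const[OF \<eta>_lim]) (auto simp: U_def)
    then have "infdist x A = 0" using infdist_nonneg[of x A] by simp
    then show "x \<in> A"
      using in_closed_iff_infdist_zero[OF compact_imp_closed[OF A(2)] A(1)] by simp
  next
    fix x assume "x \<in> A"
    then show "x \<in> (\<Inter>n. U n)" using A(3) less_imp_le[OF \<eta>] by (auto simp: U_def)
  qed
  moreover have "(\<lambda>n. measure lebesgue (U n)) \<longlonglongrightarrow> measure lebesgue (\<Inter>n. U n)"
  proof (rule Lim_measure_decseq)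
    show "range U \<subseteq> sets lebesgue" using U by (auto simp: fmeasurable_def)
    show "decseq U"
      unfolding decseq_def
    proof (intro allI impI subsetI)
      fix m n x assume "m \<le> n" and x: "x \<in> U n"
      then have "\<eta> n \<le> \<eta> m" by (simp add: \<eta>_def frac_le)
      with x show "x \<in> U m" by (simp add: U_def)
    qed
    show "emeasure lebesgue (U n) \<noteq> \<infinity>" for n using U[of n] by (auto simp: fmeasurable_def)
  qed
  ultimately have "(\<lambda>n. measure lebesgue (U n) + \<eta> n * measure lebesgue X)
      \<longlonglongrightarrow> measure lebesgue A + 0 * measure lebesgue X"
    by (intro tendsto_intros \<eta>_lim) simp
  then have "p_MA f X \<le> measure lebesgue A + 0 * measure lebesgue X"
    by (rule LIMSEQ_le_const) (use p_MA_le_neighbourhood[OF f X sca \<eta>] in \<open>auto simp: U_def\<close>)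
  then show ?thesis by simp
qed

theorem theorem3:
  fixes f :: "real^'n \<Rightarrow> real^'n" and X \<A> :: "(real^'n) set"
  assumes "compact X"
    and "locally_lipschitz f"
    and "minimal_attractor f X \<A>"
  shows "p_MA f X = measure lebesgue \<A> \<and>
    (\<forall>w J \<epsilon>. (w, J, \<epsilon>) \<in> feasible f X \<longrightarrow>
       (let K = J -` {0..\<epsilon>} \<inter> X in
          \<A> \<subseteq> K \<and> measure lebesgue (K - \<A>) \<le> cost X (w, J, \<epsilon>) - p_MA f X)) \<and>
    (\<forall>w J \<epsilon>. (\<forall>k::nat. (w k, J k, \<epsilon> k) \<in> feasible f X) \<longrightarrow>
       (\<lambda>k. cost X (w k, J k, \<epsilon> k)) \<longlonglongrightarrow> p_MA f X \<longrightarrow>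
       (\<lambda>k. cost X (w k, J k, \<epsilon> k) - p_MA f X) \<longlonglongrightarrow> 0 \<and>
       (\<lambda>k. measure lebesgue ((J k -` {0..\<epsilon> k} \<inter> X) - \<A>)) \<longlonglongrightarrow> 0) \<and>
    (\<forall>w J \<epsilon>. (w, J, \<epsilon>) \<in> feasible f X \<longrightarrow> J -` {0..\<epsilon>} \<subseteq> interior X \<longrightarrow>
       positively_invariant f (J -` {0..\<epsilon>}))"
proof -
  note X = assms(1) and f = assms(2) and min = assms(3)
  have sca: "stable_compact_attractor f X \<A>" using min by (simp add: minimal_attractor_def)
  then have A: "compact \<A>" and XB: "X \<subseteq> basin f \<A>" by (auto simp: stable_compact_attractor_def)
  have AL: "\<A> \<in> lmeasurable" by (rule lmeasurable_compact[OF A])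
  have sub: "\<A> \<subseteq> J -` {0..\<epsilon>} \<inter> X" if "(w, J, \<epsilon>) \<in> feasible f X" for w J \<epsilon>
    by (rule minimal_attractor_subset_sublevel[OF f X min that])
  have KL: "J -` {0..\<epsilon>} \<inter> X \<in> lmeasurable" if "(w, J, \<epsilon>) \<in> feasible f X" for w J \<epsilon>
    by (rule lmeasurable_compact[OF compact_sublevel[OF X that]])
  have "measure lebesgue \<A> \<le> cost X z" if "z \<in> feasible f X" for z
  proof -
    obtain w J \<epsilon> where z: "z = (w, J, \<epsilon>)" by (cases z) auto
    have "measure lebesgue \<A> \<le> measure lebesgue (J -` {0..\<epsilon>} \<inter> X)"
      using sub KL AL that unfolding z by (intro measure_mono_fmeasurable) auto
    also have "\<dots> \<le> cost X z"
      using measure_sublevel_le_cost[OF X] that unfolding z by blast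
    finally show ?thesis .
  qed
  then have "measure lebesgue \<A> \<le> p_MA f X"
    unfolding p_MA_def by (intro cINF_greatest feasible_nonempty)
  with p_MA_le_measure[OF f X sca] have p: "p_MA f X = measure lebesgue \<A>" by simp
  \<comment> \<open>Since \<open>\<A>\<close> lies in the sublevel set, the measure of the
    difference is the difference of the measures, and the optimal value stands for the measure of
    \<open>\<A>\<close>.\<close>
  have gap: "measure lebesgue ((J -` {0..\<epsilon>} \<inter> X) - \<A>) \<le> cost X (w, J, \<epsilon>) - p_MA f X"
    if feas: "(w, J, \<epsilon>) \<in> feasible f X" for w J \<epsilon>
    using measurable_measure_Diff[OF KL[OF feas] _ sub[OF feas]] AL measure_sublevel_le_cost[OF X feas]
    by (simp add: p fmeasurable_def)
  have lim: "(\<lambda>k. cost X (w k, J k, \<epsilon> k) - p_MA f X) \<longlonglongrightarrow> 0 \<and>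
       (\<lambda>k. measure lebesgue ((J k -` {0..\<epsilon> k} \<inter> X) - \<A>)) \<longlonglongrightarrow> 0"
    if feas: "\<forall>k::nat. (w k, J k, \<epsilon> k) \<in> feasible f X"
      and conv: "(\<lambda>k. cost X (w k, J k, \<epsilon> k)) \<longlonglongrightarrow> p_MA f X" for w J \<epsilon>
  proof
    show 1: "(\<lambda>k. cost X (w k, J k, \<epsilon> k) - p_MA f X) \<longlonglongrightarrow> 0"
      using conv by (simp add: LIM_zero_iff)
    show "(\<lambda>k. measure lebesgue ((J k -` {0..\<epsilon> k} \<inter> X) - \<A>)) \<longlonglongrightarrow> 0"
      by (rule tendsto_sandwich[OF _ _ tendsto_const 1]) (use gap feas in auto)
  qed
  have "positively_invariant f (J -` {0..\<epsilon>})"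
    if "(w, J, \<epsilon>) \<in> feasible f X" "J -` {0..\<epsilon>} \<subseteq> interior X" for w J \<epsilon>
    using positively_invariant_sublevel[OF f X _ that] XB by (auto simp: basin_def)
  with p sub gap lim show ?thesis unfolding Let_def by blast
qed

end
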